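(* Let $\mathbb{F}$ be a field whose characteristic is not two, let $\mathbb{O}$ be an octonion algebra over $\mathbb{F}$, and let $n\geq 4$ be an integer. Let $\mathfrak{h}_n(\mathbb{O})$ be the $\mathbb{F}$-algebra of hermitian $n\times n$ matrices over $\mathbb{O}$ under the anticommutator product $x\circ y=xy+yx$. Then, as Lie algebras over $\mathbb{F}$, $$\operatorname{der}(\mathfrak{h}_n(\mathbb{O}))\cong\mathfrak{g}_2\oplus\mathfrak{so}_n(\mathbb{F}),$$ where $\mathfrak{g}_2=\operatorname{der}(\mathbb{O})$.
   Context: An octonion algebra $\mathbb{O}$ over a field $\mathbb{F}$ of characteristic not two is a unital, alternative, 8-dimensional $\mathbb{F}$-algebra with a nondegenerate quadratic form $|\cdot|^2:\mathbb{O}\to\mathbb{F}$ that is multiplicative, i.e. $|zw|^2=|z|^2|w|^2$. Both split and division octonion algebras are allowed. The field $\mathbb{F}$ is identified with $\mathbb{F}\cdot 1\subset\mathbb{O}$. Conjugation $z\mapsto\bar z$ on $\mathbb{O}$ is the $\mathbb{F}$-linear map that fixes $\mathbb{F}\cdot 1$ pointwise and acts as $-1$ on the orthogonal complement of $1$ with respect to the bilinear form associated with $|\cdot|^2$; that is, in an orthogonal basis $1,e_1,\dots,e_7$, $\overline{z_0+\sum_i z_ie_i}=z_0-\sum_i z_ie_i$. For an $n\times n$ matrix $x$ with entries in $\mathbb{O}$, $x^*$ denotes the matrix obtained by transposing $x$ and conjugating all entries; $x$ is hermitian if $x^*=x$. The set of hermitian $n\times n$ matrices is $\mathfrak{h}_n(\mathbb{O})$,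 which is an $\mathbb{F}$-algebra under $x\circ y=xy+yx$, where $xy$ is the usual matrix product. For an (arbitrary nonassociative) $\mathbb{F}$-algebra $A$, $\operatorname{der}(A)$ is the Lie algebra, under the commutator, of all $\mathbb{F}$-linear maps $\partial:A\to A$ with $\partial(ab)=\partial(a)b+a\partial(b)$ for all $a,b\in A$. The notation $\mathfrak{g}_2$ means $\operatorname{der}(\mathbb{O})$ for the given $\mathbb{O}$. $\mathfrak{so}_n(\mathbb{F})$ is the Lie algebra of antisymmetric $n\times n$ matrices with entries in $\mathbb{F}$ under the commutator product. $\oplus$ denotes the direct sum of Lie algebras. *)

theory Defs
  imports "HOL-Analysis.Analysis" "HOL-Library.Function_Algebras"
begin

section \<open>Nonassociative algebras and Lie algebras\<close>

text \<open>
  A not necessarily associative algebra over a field is a linear subspace of an ambient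
  vector space, together with a product on it. Addition is that of the ambient type. What the
  product does outside the carrier is irrelevant.
\<close>

record ('f, 'a) nalg =
  ncarrier :: "'a set"
  nscale :: "'f \<Rightarrow> 'a \<Rightarrow> 'a"
  nprod :: "'a \<Rightarrow> 'a \<Rightarrow> 'a"

definition is_nalg :: "('f::field, 'a::ab_group_add) nalg \<Rightarrow> bool" where
  "is_nalg A \<longleftrightarrow>
     vector_space (nscale A) \<and>
     module.subspace (nscale A) (ncarrier A) \<and>
     (\<forall>x\<in>ncarrier A. \<forall>y\<in>ncarrier A. nprod A x y \<in> ncarrier A) \<and>
     (\<forall>x\<in>ncarrier A. \<forall>y\<in>ncarrier A. \<forall>z\<in>ncarrier A.
        nprod A (x + y) z = nprod A x z + nprod A y z \<and>
        nprod A x (y + z) = nprod A x y + nprod A x z) \<and>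
     (\<forall>c. \<forall>x\<in>ncarrier A. \<forall>y\<in>ncarrier A.
        nprod A (nscale A c x) y = nscale A c (nprod A x y) \<and>
        nprod A x (nscale A c y) = nscale A c (nprod A x y))"

definition is_lie_algebra :: "('f::field, 'a::ab_group_add) nalg \<Rightarrow> bool" where
  "is_lie_algebra L \<longleftrightarrow>
     is_nalg L \<and>
     (\<forall>x\<in>ncarrier L. nprod L x x = 0) \<and>
     (\<forall>x\<in>ncarrier L. \<forall>y\<in>ncarrier L. \<forall>z\<in>ncarrier L.
        nprod L x (nprod L y z) + nprod L y (nprod L z x) + nprod L z (nprod L x y) = 0)"

definition nalg_iso ::
    "('f::field, 'a::ab_group_add) nalg \<Rightarrow> ('f, 'b::ab_group_add) nalg \<Rightarrow> ('a \<Rightarrow> 'b) \<Rightarrow> bool" where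
  "nalg_iso A B \<phi> \<longleftrightarrow>
     bij_betw \<phi> (ncarrier A) (ncarrier B) \<and>
     (\<forall>x\<in>ncarrier A. \<forall>y\<in>ncarrier A. \<phi> (x + y) = \<phi> x + \<phi> y) \<and>
     (\<forall>c. \<forall>x\<in>ncarrier A. \<phi> (nscale A c x) = nscale B c (\<phi> x)) \<and>
     (\<forall>x\<in>ncarrier A. \<forall>y\<in>ncarrier A. \<phi> (nprod A x y) = nprod B (\<phi> x) (\<phi> y))"

definition nalg_isomorphic ::
    "('f::field, 'a::ab_group_add) nalg \<Rightarrow> ('f, 'b::ab_group_add) nalg \<Rightarrow> bool" (infix "\<cong>\<^sub>L" 50) where
  "A \<cong>\<^sub>L B \<longleftrightarrow> (\<exists>\<phi>. nalg_iso A B \<phi>)"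

definition nalg_sum ::
    "('f::field, 'a::ab_group_add) nalg \<Rightarrow> ('f, 'b::ab_group_add) nalg \<Rightarrow> ('f, 'a \<times> 'b) nalg"
    (infixr "\<oplus>\<^sub>L" 65) where
  "A \<oplus>\<^sub>L B =
     \<lparr>ncarrier = ncarrier A \<times> ncarrier B,
      nscale = (\<lambda>c (x, y). (nscale A c x, nscale B c y)),
      nprod = (\<lambda>(x, y) (x', y'). (nprod A x x', nprod B y y'))\<rparr>"

text \<open>
  A linear map from the carrier to itself is represented by the unique HOL function that extends
  it by 0 off the carrier, so that equality of derivations is equality on the carrier.
\<close>

definition derivations :: "('f::field, 'a::ab_group_add) nalg \<Rightarrow> ('a \<Rightarrow> 'a) set" where
  "derivations A = {D.
     (\<forall>x\<in>ncarrier A. D x \<in> ncarrier A) \<and>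
     (\<forall>x. x \<notin> ncarrier A \<longrightarrow> D x = 0) \<and>
     (\<forall>x\<in>ncarrier A. \<forall>y\<in>ncarrier A. D (x + y) = D x + D y) \<and>
     (\<forall>c. \<forall>x\<in>ncarrier A. D (nscale A c x) = nscale A c (D x)) \<and>
     (\<forall>x\<in>ncarrier A. \<forall>y\<in>ncarrier A.
        D (nprod A x y) = nprod A (D x) y + nprod A x (D y))}"

definition der :: "('f::field, 'a::ab_group_add) nalg \<Rightarrow> ('f, 'a \<Rightarrow> 'a) nalg" where
  "der A =
     \<lparr>ncarrier = derivations A,
      nscale = (\<lambda>c D x. nscale A c (D x)),
      nprod = (\<lambda>D E. (D \<circ> E) - (E \<circ> D))\<rparr>"

definition so_alg :: "('f::field, 'f ^ 'n ^ 'n) nalg" where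
  "so_alg =
     \<lparr>ncarrier = {M. transpose M = - M},
      nscale = (\<lambda>c M. \<chi> i j. c * M $ i $ j),
      nprod = (\<lambda>M M'. M ** M' - M' ** M)\<rparr>"


section \<open>Octonion algebras\<close>

definition polar :: "('o::ab_group_add \<Rightarrow> 'f::field) \<Rightarrow> 'o \<Rightarrow> 'o \<Rightarrow> 'f" where
  "polar N x y = N (x + y) - N x - N y"

locale octonion_algebra = vector_space scl
  for scl :: "'f::field \<Rightarrow> 'o::ab_group_add \<Rightarrow> 'o" +
  fixes mul :: "'o \<Rightarrow> 'o \<Rightarrow> 'o" and one :: 'o and N :: "'o \<Rightarrow> 'f"
  assumes dim_8: "dim UNIV = 8"
    and mul_linear_right: "Vector_Spaces.linear scl scl (\<lambda>y. mul x y)"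
    and mul_linear_left: "Vector_Spaces.linear scl scl (\<lambda>x. mul x y)"
    and one_mul: "mul one x = x"
    and mul_one: "mul x one = x"
    and left_alternative: "mul x (mul x y) = mul (mul x x) y"
    and right_alternative: "mul (mul y x) x = mul y (mul x x)"
    and N_scale: "N (scl c x) = c\<^sup>2 * N x"
    and polar_linear: "Vector_Spaces.linear scl (*) (\<lambda>y. polar N x y)"
    and N_nondegenerate: "(\<And>y. polar N x y = 0) \<Longrightarrow> x = 0"
    and N_mul: "N (mul x y) = N x * N y"

definition oct_alg :: "('f \<Rightarrow> 'o \<Rightarrow> 'o) \<Rightarrow> ('o \<Rightarrow> 'o \<Rightarrow> 'o) \<Rightarrow> ('f::field, 'o::ab_group_add) nalg" where
  "oct_alg scl mul = \<lparr>ncarrier = UNIV, nscale = scl, nprod = mul\<rparr>"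

text \<open>Existence and uniqueness, in characteristic not two, are shown in \<open>oconj_unique\<close> below.\<close>

definition is_oconj ::
    "('f::field \<Rightarrow> 'o::ab_group_add \<Rightarrow> 'o) \<Rightarrow> 'o \<Rightarrow> ('o \<Rightarrow> 'f) \<Rightarrow> ('o \<Rightarrow> 'o) \<Rightarrow> bool" where
  "is_oconj scl one N \<sigma> \<longleftrightarrow>
     Vector_Spaces.linear scl scl \<sigma> \<and>
     (\<forall>c. \<sigma> (scl c one) = scl c one) \<and>
     (\<forall>x. polar N one x = 0 \<longrightarrow> \<sigma> x = - x)"

definition oconj ::
    "('f::field \<Rightarrow> 'o::ab_group_add \<Rightarrow> 'o) \<Rightarrow> 'o \<Rightarrow> ('o \<Rightarrow> 'f) \<Rightarrow> 'o \<Rightarrow> 'o" where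
  "oconj scl one N = (THE \<sigma>. is_oconj scl one N \<sigma>)"


section \<open>Hermitian matrices\<close>

text \<open>The library product \<open>**\<close> needs an associative semiring of entries.\<close>

definition omatmul ::
    "('o::ab_group_add \<Rightarrow> 'o \<Rightarrow> 'o) \<Rightarrow> 'o ^ 'n ^ 'n \<Rightarrow> 'o ^ 'n ^ 'n \<Rightarrow> 'o ^ 'n ^ 'n" where
  "omatmul mul x y = (\<chi> i j. \<Sum>k\<in>UNIV. mul (x $ i $ k) (y $ k $ j))"

definition adjoint_matrix ::
    "('f::field \<Rightarrow> 'o::ab_group_add \<Rightarrow> 'o) \<Rightarrow> 'o \<Rightarrow> ('o \<Rightarrow> 'f) \<Rightarrow> 'o ^ 'n ^ 'n \<Rightarrow> 'o ^ 'n ^ 'n" where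
  "adjoint_matrix scl one N x = map_matrix (oconj scl one N) (transpose x)"

definition herm_alg ::
    "('f::field \<Rightarrow> 'o::ab_group_add \<Rightarrow> 'o) \<Rightarrow> ('o \<Rightarrow> 'o \<Rightarrow> 'o) \<Rightarrow> 'o \<Rightarrow> ('o \<Rightarrow> 'f) \<Rightarrow>
     ('f, 'o ^ 'n ^ 'n) nalg" where
  "herm_alg scl mul one N =
     \<lparr>ncarrier = {x. adjoint_matrix scl one N x = x},
      nscale = (\<lambda>c x. \<chi> i j. scl c (x $ i $ j)),
      nprod = (\<lambda>x y. omatmul mul x y + omatmul mul y x)\<rparr>"


section \<open>Well-definedness\<close>

context
  fixes A :: "('f::field, 'a::ab_group_add) nalg"
  assumes A: "is_nalg A"
begin

lemma ncarrier_rules: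
  shows ncarrier_zero: "0 \<in> ncarrier A"
    and ncarrier_add: "x \<in> ncarrier A \<Longrightarrow> y \<in> ncarrier A \<Longrightarrow> x + y \<in> ncarrier A"
    and ncarrier_diff: "x \<in> ncarrier A \<Longrightarrow> y \<in> ncarrier A \<Longrightarrow> x - y \<in> ncarrier A"
    and ncarrier_scale: "x \<in> ncarrier A \<Longrightarrow> nscale A c x \<in> ncarrier A"
    and ncarrier_prod: "x \<in> ncarrier A \<Longrightarrow> y \<in> ncarrier A \<Longrightarrow> nprod A x y \<in> ncarrier A"
proof -
  interpret vector_space "nscale A" using A by (simp add: is_nalg_def)
  have S: "subspace (ncarrier A)" using A by (simp add: is_nalg_def)
  show "0 \<in> ncarrier A"
    and "x \<in> ncarrier A \<Longrightarrow> y \<in> ncarrier A \<Longrightarrow> x + y \<in> ncarrier A"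
    and "x \<in> ncarrier A \<Longrightarrow> y \<in> ncarrier A \<Longrightarrow> x - y \<in> ncarrier A"
    and "x \<in> ncarrier A \<Longrightarrow> nscale A c x \<in> ncarrier A"
    using S by (auto intro: subspace_0 subspace_add subspace_diff subspace_scale)
  show "x \<in> ncarrier A \<Longrightarrow> y \<in> ncarrier A \<Longrightarrow> nprod A x y \<in> ncarrier A"
    using A by (simp add: is_nalg_def)
qed

lemma nprod_linear:
  assumes "x \<in> ncarrier A" "y \<in> ncarrier A"
  shows "z \<in> ncarrier A \<Longrightarrow> nprod A (x + y) z = nprod A x z + nprod A y z"
    and "z \<in> ncarrier A \<Longrightarrow> nprod A x (y + z) = nprod A x y + nprod A x z"
    and "nprod A (nscale A c x) y = nscale A c (nprod A x y)"
    and "nprod A x (nscale A c y) = nscale A c (nprod A x y)"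
  using A assms by (simp_all add: is_nalg_def)

lemma nprod_diff:
  assumes "x \<in> ncarrier A" "y \<in> ncarrier A" "z \<in> ncarrier A"
  shows "nprod A (x - y) z = nprod A x z - nprod A y z"
    and "nprod A z (x - y) = nprod A z x - nprod A z y"
  using nprod_linear(1)[of "x - y" y z] nprod_linear(2)[of z "x - y" y] assms
  by (simp_all add: ncarrier_rules)

lemma nprod_zero:
  assumes "x \<in> ncarrier A"
  shows "nprod A 0 x = 0" and "nprod A x 0 = 0"
  using nprod_diff[of 0 0 x] assms by (simp_all add: ncarrier_rules)

lemma derivation_rules:
  assumes D: "D \<in> derivations A"
  shows derivation_closed: "x \<in> ncarrier A \<Longrightarrow> D x \<in> ncarrier A"
    and derivation_off: "x \<notin> ncarrier A \<Longrightarrow> D x = 0"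
    and derivation_add: "x \<in> ncarrier A \<Longrightarrow> y \<in> ncarrier A \<Longrightarrow> D (x + y) = D x + D y"
    and derivation_scale: "x \<in> ncarrier A \<Longrightarrow> D (nscale A c x) = nscale A c (D x)"
    and derivation_prod: "x \<in> ncarrier A \<Longrightarrow> y \<in> ncarrier A \<Longrightarrow>
        D (nprod A x y) = nprod A (D x) y + nprod A x (D y)"
  using D by (simp_all add: derivations_def)

lemma derivation_diff:
  assumes "D \<in> derivations A" "x \<in> ncarrier A" "y \<in> ncarrier A"
  shows "D (x - y) = D x - D y"
  using derivation_add[of D "x - y" y] assms by (simp add: ncarrier_rules)

lemma derivation_zero:
  assumes "D \<in> derivations A"
  shows "D 0 = 0"
  using derivation_diff[OF assms, of 0 0] ncarrier_zero by simp

lemmas derivation_simps =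
  ncarrier_rules nprod_linear nprod_diff nprod_zero derivation_rules derivation_diff derivation_zero

lemma derivations_eqI:
  assumes "\<And>x. x \<in> ncarrier A \<Longrightarrow> f x = g x" "\<And>x. x \<notin> ncarrier A \<Longrightarrow> f x = g x"
  shows "f = g"
  using assms by blast

lemma bracket_derivation:
  assumes D: "D \<in> derivations A" and E: "E \<in> derivations A"
  shows "(D \<circ> E) - (E \<circ> D) \<in> derivations A"
proof -
  interpret vector_space "nscale A" using A by (simp add: is_nalg_def)
  show ?thesis
    unfolding derivations_def
    using D E by (simp add: derivation_simps scale_right_diff_distrib)
qed

lemma is_lie_algebra_der: "is_lie_algebra (der A)"
proof -
  interpret vector_space "nscale A" using A by (simp add: is_nalg_def)
  interpret d: vector_space "nscale (der A)"
    by unfold_locales (auto simp: der_def fun_eq_iff algebra_simps)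
  have "d.subspace (derivations A)"
    unfolding d.subspace_def derivations_def
    by (simp add: der_def ncarrier_rules nprod_linear nprod_zero scale_right_distrib mult.commute)
  moreover have bracket: "nprod (der A) D E = (\<lambda>x. D (E x) - E (D x))" for D E
    by (auto simp: der_def)
  moreover have "nprod (der A) (D + E) G = nprod (der A) D G + nprod (der A) E G"
      "nprod (der A) D (E + G) = nprod (der A) D E + nprod (der A) D G"
    if "D \<in> derivations A" "E \<in> derivations A" "G \<in> derivations A" for D E G
    using that unfolding bracket by - (rule derivations_eqI; simp add: derivation_simps)+
  moreover have "nprod (der A) (nscale (der A) c D) E = nscale (der A) c (nprod (der A) D E)"
      "nprod (der A) D (nscale (der A) c E) = nscale (der A) c (nprod (der A) D E)"
    if "D \<in> derivations A" "E \<in> derivations A" for c D E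
    using that unfolding bracket
    by - (rule derivations_eqI; simp add: der_def derivation_simps scale_right_diff_distrib)+
  moreover have "nprod (der A) D E \<in> derivations A"
    if "D \<in> derivations A" "E \<in> derivations A" for D E
    using bracket_derivation that by (simp add: der_def)
  moreover have carrier: "ncarrier (der A) = derivations A"
    by (simp add: der_def)
  ultimately have "is_nalg (der A)"
    unfolding is_nalg_def carrier using d.vector_space_axioms by blast
  moreover have "nprod (der A) D (nprod (der A) E G) + nprod (der A) E (nprod (der A) G D) +
      nprod (der A) G (nprod (der A) D E) = 0"
    if "D \<in> derivations A" "E \<in> derivations A" "G \<in> derivations A" for D E G
    using that unfolding bracket by - (rule derivations_eqI; simp add: derivation_simps)
  moreover have "nprod (der A) D D = 0" for D
    by (simp add: der_def)
  ultimately show ?thesis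
    unfolding is_lie_algebra_def carrier by blast
qed

end

lemma is_lie_algebra_so: "is_lie_algebra (so_alg :: ('f::field, 'f ^ 'n ^ 'n) nalg)"
proof -
  interpret vector_space "nscale (so_alg :: ('f, 'f ^ 'n ^ 'n) nalg)"
    by unfold_locales (auto simp: so_alg_def vec_eq_iff algebra_simps)
  have dl: "(X - Y) ** Z = X ** Z - Y ** Z" and dr: "Z ** (X - Y) = Z ** X - Z ** Y"
    for X Y Z :: "'f ^ 'n ^ 'n"
    by (simp_all add: matrix_matrix_mult_def vec_eq_iff algebra_simps sum_subtractf)
  have al: "(X + Y) ** Z = X ** Z + Y ** Z" and ar: "Z ** (X + Y) = Z ** X + Z ** Y"
    for X Y Z :: "'f ^ 'n ^ 'n"
    by (simp_all add: matrix_matrix_mult_def vec_eq_iff algebra_simps sum.distrib)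
  have nl: "(- X) ** Z = - (X ** Z)" and nr: "Z ** (- X) = - (Z ** X)"
    for X Z :: "'f ^ 'n ^ 'n"
    by (simp_all add: matrix_matrix_mult_def vec_eq_iff sum_negf)
  have sl: "(\<chi> i j. c * X $ i $ j) ** Z = (\<chi> i j. c * (X ** Z) $ i $ j)"
    and sr: "Z ** (\<chi> i j. c * X $ i $ j) = (\<chi> i j. c * (Z ** X) $ i $ j)"
    for c and X Z :: "'f ^ 'n ^ 'n"
    by (simp_all add: matrix_matrix_mult_def vec_eq_iff sum_distrib_left algebra_simps)
  have td: "transpose (X - Y) = transpose X - transpose Y"
    and ta: "transpose (X + Y) = transpose X + transpose Y"
    and ts: "transpose (\<chi> i j. c * X $ i $ j) = (\<chi> i j. c * transpose X $ i $ j)"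
    and sn: "(\<chi> i j. c * (- X) $ i $ j) = - (\<chi> i j. c * X $ i $ j)"
    and t0: "transpose (0 :: 'f ^ 'n ^ 'n) = 0"
    for c and X Y :: "'f ^ 'n ^ 'n"
    by (simp_all add: transpose_def vec_eq_iff)
  have "subspace {M :: 'f ^ 'n ^ 'n. transpose M = - M}"
    unfolding subspace_def
    by (simp add: so_alg_def ta ts t0 sn del: vector_uminus_component)
  moreover have "(\<chi> i j. c * (X - Y) $ i $ j) = (\<chi> i j. c * X $ i $ j) - (\<chi> i j. c * Y $ i $ j)"
    for c and X Y :: "'f ^ 'n ^ 'n"
    by (simp add: vec_eq_iff algebra_simps)
  ultimately have "is_nalg (so_alg :: ('f, 'f ^ 'n ^ 'n) nalg)"
    using vector_space_axioms unfolding is_nalg_def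
    by (simp add: so_alg_def al ar sl sr td matrix_transpose_mul nl nr)
  then show ?thesis
    by (simp add: is_lie_algebra_def so_alg_def dl dr matrix_mul_assoc)
qed

lemma is_lie_algebra_sum:
  assumes "is_lie_algebra L" "is_lie_algebra M"
  shows "is_lie_algebra (L \<oplus>\<^sub>L M)"
proof -
  interpret l: vector_space "nscale L" using assms by (simp add: is_lie_algebra_def is_nalg_def)
  interpret m: vector_space "nscale M" using assms by (simp add: is_lie_algebra_def is_nalg_def)
  interpret p: vector_space "nscale (L \<oplus>\<^sub>L M)"
    by unfold_locales (auto simp: nalg_sum_def algebra_simps)
  have "p.subspace (ncarrier (L \<oplus>\<^sub>L M))"
    using assms unfolding p.subspace_def
    by (auto simp: nalg_sum_def is_lie_algebra_def is_nalg_def l.subspace_def m.subspace_def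
        zero_prod_def)
  then show ?thesis
    using assms p.vector_space_axioms
    unfolding is_lie_algebra_def is_nalg_def
    by (auto simp: nalg_sum_def zero_prod_def)
qed

context octonion_algebra
begin

lemma mul_simps:
  "mul (x + y) z = mul x z + mul y z" "mul (scl c x) z = scl c (mul x z)"
  "mul z (x + y) = mul z x + mul z y" "mul z (scl c x) = scl c (mul z x)"
  "mul (x - y) z = mul x z - mul y z" "mul z (x - y) = mul z x - mul z y"
proof -
  interpret l: Vector_Spaces.linear scl scl "\<lambda>x. mul x z" by (rule mul_linear_left)
  interpret r: Vector_Spaces.linear scl scl "\<lambda>x. mul z x" by (rule mul_linear_right)
  show "mul (x + y) z = mul x z + mul y z" "mul (scl c x) z = scl c (mul x z)"
    "mul z (x + y) = mul z x + mul z y" "mul z (scl c x) = scl c (mul z x)"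
    "mul (x - y) z = mul x z - mul y z" "mul z (x - y) = mul z x - mul z y"
    by (rule l.add l.scale r.add r.scale l.diff r.diff)+
qed

lemma polar_commute: "polar N x y = polar N y x"
  by (simp add: polar_def add.commute)

lemma polar_simps:
  "polar N z (x + y) = polar N z x + polar N z y" "polar N z (scl c x) = c * polar N z x"
  "polar N (x + y) z = polar N x z + polar N y z" "polar N (scl c x) z = c * polar N x z"
  "polar N z (x - y) = polar N z x - polar N z y" "polar N (x - y) z = polar N x z - polar N y z"
proof -
  interpret r: Vector_Spaces.linear scl "(*)" "\<lambda>x. polar N z x" by (rule polar_linear)
  show "polar N z (x + y) = polar N z x + polar N z y" "polar N z (scl c x) = c * polar N z x"
    "polar N (x + y) z = polar N x z + polar N y z" "polar N (scl c x) z = c * polar N x z"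
    "polar N z (x - y) = polar N z x - polar N z y" "polar N (x - y) z = polar N x z - polar N y z"
    using r.add[of x y] r.scale[of c x] r.diff[of x y] by (simp_all add: polar_commute[of _ z])
qed

lemma polar_eqI: "(\<And>z. polar N x z = polar N y z) \<Longrightarrow> x = y"
  using N_nondegenerate[of "x - y"] by (simp add: polar_simps)

lemma is_nalg_oct_alg: "is_nalg (oct_alg scl mul)"
  using vector_space_axioms by (simp add: is_nalg_def oct_alg_def mul_simps)

lemma N_add: "N (x + y) = N x + N y + polar N x y"
  by (simp add: polar_def)

lemma N_one: "N one = 1"
proof -
  have "\<exists>a :: 'o. a \<noteq> 0"
  proof (rule ccontr)
    assume "\<nexists>a :: 'o. a \<noteq> 0"
    then have "(UNIV :: 'o set) \<subseteq> span {}" by (auto simp: span_empty)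
    then have "dim UNIV \<le> card ({} :: 'o set)" by (rule dim_le_card) simp
    then show False by (simp add: dim_8)
  qed
  then obtain a :: 'o where "a \<noteq> 0" by blast
  then obtain b where "polar N a b \<noteq> 0" using N_nondegenerate by blast
  then obtain c where "N c \<noteq> 0" unfolding polar_def by force
  then show ?thesis using N_mul[of one c] by (simp add: one_mul)
qed

lemma polar_one_one: "polar N one one = 2"
  using N_scale[of 2 one] scale_left_distrib[of 1 1 one] by (simp add: polar_def N_one)

lemma two_nonzero: "CHAR('f) \<noteq> 2 \<Longrightarrow> (2 :: 'f) \<noteq> 0"
proof
  assume "CHAR('f) \<noteq> 2" "(2 :: 'f) = 0"
  then have "CHAR('f) dvd 2"
    using of_nat_eq_0_iff_char_dvd[where 'a = 'f, of 2] by simp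
  then have "CHAR('f) = 1" using \<open>CHAR('f) \<noteq> 2\<close> two_is_prime_nat
    by (auto simp: prime_nat_iff)
  then show False using of_nat_CHAR[where 'a = 'f] by simp
qed

lemma oconj_unique:
  assumes two: "(2 :: 'f) \<noteq> 0"
  shows "is_oconj scl one N \<sigma> \<longleftrightarrow> \<sigma> = (\<lambda>z. scl (polar N one z) one - z)"
proof
  assume s: "is_oconj scl one N \<sigma>"
  then interpret s: Vector_Spaces.linear scl scl \<sigma> by (simp add: is_oconj_def)
  show "\<sigma> = (\<lambda>z. scl (polar N one z) one - z)"
  proof
    fix z
    let ?u = "scl (polar N one z / 2) one"
    have "polar N one (z - ?u) = 0" using two by (simp add: polar_simps polar_one_one)
    then have "\<sigma> (z - ?u) = - (z - ?u)" "\<sigma> ?u = ?u" using s by (auto simp: is_oconj_def)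
    then have "\<sigma> z = (?u + ?u) - z" by (simp add: s.diff algebra_simps)
    also have "?u + ?u = scl (polar N one z) one"
      using two by (simp flip: scale_left_distrib add: field_simps)
    finally show "\<sigma> z = scl (polar N one z) one - z" .
  qed
next
  assume s: "\<sigma> = (\<lambda>z. scl (polar N one z) one - z)"
  have "Vector_Spaces.linear scl scl \<sigma>"
    unfolding s by unfold_locales (simp_all add: polar_simps algebra_simps)
  moreover have "scl (c * 2) one - scl c one = scl c one" for c
    by (simp flip: scale_left_diff_distrib)
  ultimately show "is_oconj scl one N \<sigma>"
    by (simp add: is_oconj_def s polar_simps polar_one_one)
qed

lemma oconj_eq:
  assumes "CHAR('f) \<noteq> 2"
  shows "oconj scl one N z = scl (polar N one z) one - z"
  unfolding oconj_def oconj_unique[OF two_nonzero[OF assms]] by simp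

lemma polar_mul_left: "polar N (mul x y) (mul x z) = N x * polar N y z"
  by (simp add: polar_def N_mul algebra_simps flip: mul_simps)

lemma polar_mul_right: "polar N (mul y x) (mul z x) = polar N y z * N x"
  by (simp add: polar_def N_mul algebra_simps flip: mul_simps)

lemma polar_exchange:
  "polar N (mul x y) (mul w z) + polar N (mul w y) (mul x z) = polar N x w * polar N y z"
  using polar_mul_left[of "x + w" y z]
  by (simp add: mul_simps polar_simps polar_mul_left N_add polar_commute[of w x] algebra_simps)

lemma oconj_mul:
  assumes "CHAR('f) \<noteq> 2"
  shows "oconj scl one N (mul x y) = mul (oconj scl one N y) (oconj scl one N x)"
proof -
  let ?c = "oconj scl one N"
  note c = oconj_eq[OF assms]
  have l: "polar N (mul u v) w = polar N v (mul (?c u) w)" for u v w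
    using polar_exchange[of u v one w]
    by (simp add: c mul_simps polar_simps one_mul polar_commute[of one u] algebra_simps)
  have r: "polar N (mul u v) w = polar N u (mul w (?c v))" for u v w
    using polar_exchange[of u v w one]
    by (simp add: c mul_simps polar_simps mul_one polar_commute[of one v]
        polar_commute[of "mul w v" u] algebra_simps)
  have cc: "?c (?c z) = z" for z
    using two_nonzero[OF assms]
    by (simp add: c polar_simps polar_one_one flip: scale_left_diff_distrib) 
  show ?thesis
  proof (rule polar_eqI)
    fix z
    have "polar N (?c (mul x y)) z = polar N one (mul (mul x y) z)"
      using l[of "mul x y" z one] cc l[of "?c (mul x y)" one z] by (simp add: mul_one polar_commute)
    also have "\<dots> = polar N (mul x y) (?c z)"
      using r[of "mul x y" z one] by (simp add: one_mul polar_commute)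
    also have "\<dots> = polar N (mul (?c z) (?c y)) x"
      using r by (simp add: polar_commute)
    also have "\<dots> = polar N (mul z x) (?c y)"
      using l[of "?c z"] cc by (simp add: polar_commute)
    also have "\<dots> = polar N (mul (?c y) (?c x)) z"
      using r by (simp add: polar_commute)
    finally show "polar N (?c (mul x y)) z = polar N (mul (?c y) (?c x)) z" .
  qed
qed

lemma is_nalg_herm_alg:
  assumes "CHAR('f) \<noteq> 2"
  shows "is_nalg (herm_alg scl mul one N :: ('f, 'o ^ 'n ^ 'n) nalg)"
proof -
  let ?H = "herm_alg scl mul one N :: ('f, 'o ^ 'n ^ 'n) nalg"
  let ?c = "oconj scl one N"
  interpret v: vector_space "nscale ?H"
    by unfold_locales (auto simp: herm_alg_def vec_eq_iff algebra_simps)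
  interpret c: Vector_Spaces.linear scl scl ?c
    unfolding oconj_eq[OF assms, abs_def]
    by unfold_locales (simp_all add: polar_simps algebra_simps)
  have herm: "x \<in> ncarrier ?H \<longleftrightarrow> (\<forall>i j. ?c (x $ j $ i) = x $ i $ j)" for x
    by (simp add: herm_alg_def adjoint_matrix_def map_matrix_def transpose_def vec_eq_iff)
  have "v.subspace (ncarrier ?H)"
    unfolding v.subspace_def Ball_def herm by (simp add: herm_alg_def c.add c.scale)
  moreover have "nprod ?H x y \<in> ncarrier ?H" if "x \<in> ncarrier ?H" "y \<in> ncarrier ?H" for x y
    using that unfolding herm
    by (simp add: herm_alg_def omatmul_def c.add c.sum oconj_mul[OF assms] add.commute)
  ultimately show ?thesis
    using v.vector_space_axioms unfolding is_nalg_def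
    by (simp add: herm_alg_def omatmul_def vec_eq_iff mul_simps sum.distrib scale_sum_right
        scale_right_distrib algebra_simps)
qed

end

end

theory Submission
  imports Defs
begin

text \<open>
  The left nucleus of \<open>O\<close> consists of the scalars: its elements are orthogonal to all associators,
  and every imaginary octonion is a sum of associators \<open>(i, j, v) = 2 (i j) v\<close> with \<open>v\<close> orthogonal to
  \<open>1, i, j, i j\<close>. For a derivation \<open>D\<close> of the hermitian matrices,
  comparing entries in \<open>D (a\<^bsub>ij\<^esub> \<circ> b\<^bsub>jk\<^esub>)\<close> at a fourth index \<open>l\<close> shows that the entries of
  \<open>D e\<^sub>i\<close> lie in the nucleus, so they form an antisymmetric scalar matrix \<open>S\<close>. Subtracting
  \<open>x \<mapsto> S x - x S\<close> leaves a derivation that kills all \<open>e\<^sub>i\<close> and hence acts by linear maps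
  \<open>d\<^bsub>ij\<^esub>\<close> on the off-diagonal Peirce spaces, with \<open>d\<^bsub>ik\<^esub> (a b) = d\<^bsub>ij\<^esub> (a) b + a d\<^bsub>jk\<^esub> (b)\<close>.
  A fourth index puts \<open>d\<^bsub>ij\<^esub> (1)\<close> in the nucleus as well; this forces \<open>d\<^bsub>ij\<^esub> (1) = 0\<close>, so all
  \<open>d\<^bsub>ij\<^esub>\<close> are one and the same derivation of \<open>O\<close>.
\<close>

section \<open>Generalities on matrices, isomorphisms and indices\<close>

lemma antisymmetric_nth:
  fixes S :: "'a::ab_group_add ^ 'n ^ 'n"
  assumes "transpose S = - S"
  shows "S $ j $ i = - S $ i $ j"
proof -
  have "S $ j $ i = transpose S $ i $ j" by (simp add: transpose_def)
  then show ?thesis by (simp add: assms)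
qed

text \<open>Allows an isomorphism to be built in the direction that has an explicit formula and then
  inverted. Closure of the carrier of \<open>A\<close> under its operations is what makes the
  inverse respect them.\<close>

lemma nalg_iso_sym:
  fixes A :: "('f::field, 'a::ab_group_add) nalg" and B :: "('f, 'b::ab_group_add) nalg"
  assumes A: "is_nalg A" and iso: "nalg_iso A B \<phi>"
  shows "nalg_iso B A (inv_into (ncarrier A) \<phi>)"
proof -
  let ?g = "inv_into (ncarrier A) \<phi>"
  have bij: "bij_betw \<phi> (ncarrier A) (ncarrier B)" using iso by (simp add: nalg_iso_def)
  have g: "?g y \<in> ncarrier A" "\<phi> (?g y) = y" if "y \<in> ncarrier B" for y
    using bij that by (auto simp: bij_betw_def inv_into_into f_inv_into_f)
  have gI: "?g y = x" if "x \<in> ncarrier A" "\<phi> x = y" for x y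
    using bij that by (auto simp: bij_betw_def)
  show ?thesis
    unfolding nalg_iso_def
    using iso by (intro conjI allI ballI gI bij_betw_inv_into bij)
      (simp_all add: g nalg_iso_def ncarrier_rules[OF A])
qed

text \<open>The three given indices may coincide, so repeated arguments also yield a second or third
  index.\<close>

lemma obtain_fourth_index:
  fixes i j k :: "'n::finite"
  assumes "CARD('n) \<ge> 4"
  obtains l where "l \<noteq> i" "l \<noteq> j" "l \<noteq> k"
proof -
  have "card {i, j, k} \<le> 3" by (simp add: card_insert_if)
  then have "{i, j, k} \<noteq> UNIV" using assms by auto
  then show thesis using that by blast
qed

section \<open>Scalar matrices acting on matrices of vectors\<close>

text \<open>The product of \<open>S\<close> and \<open>x\<close> formed with \<open>scl\<close>
  instead of \<open>mul\<close>, so that its algebra rests on the vector space axioms alone.\<close>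

definition left_act :: "('f::field \<Rightarrow> 'o::ab_group_add \<Rightarrow> 'o) \<Rightarrow> 'f ^ 'n ^ 'n \<Rightarrow> 'o ^ 'n ^ 'n \<Rightarrow> 'o ^ 'n ^ 'n" where
  "left_act scl S x = (\<chi> i j. \<Sum>k\<in>UNIV. scl (S $ i $ k) (x $ k $ j))"

definition right_act :: "('f::field \<Rightarrow> 'o::ab_group_add \<Rightarrow> 'o) \<Rightarrow> 'f ^ 'n ^ 'n \<Rightarrow> 'o ^ 'n ^ 'n \<Rightarrow> 'o ^ 'n ^ 'n" where
  "right_act scl S x = (\<chi> i j. \<Sum>k\<in>UNIV. scl (S $ k $ j) (x $ i $ k))"

context vector_space
begin

lemma left_act_simps:
  "left_act scale S (x + y) = left_act scale S x + left_act scale S y"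
  "left_act scale S (x - y) = left_act scale S x - left_act scale S y"
  "left_act scale (S + T) x = left_act scale S x + left_act scale T x"
  "left_act scale (S - T) x = left_act scale S x - left_act scale T x"
  "left_act scale (S ** T) x = left_act scale S (left_act scale T x)"
  "left_act scale 0 x = 0" "left_act scale S 0 = 0"
proof -
  show "left_act scale (S ** T) x = left_act scale S (left_act scale T x)"
    by (simp add: left_act_def matrix_matrix_mult_def vec_eq_iff scale_sum_left scale_sum_right)
      (intro allI sum.swap)
qed (simp_all add: left_act_def vec_eq_iff algebra_simps sum.distrib sum_subtractf)

text \<open>In contrast to the left action, the right action reverses the order of a product
  \<open>S ** T\<close>.\<close>

lemma right_act_simps:
  "right_act scale S (x + y) = right_act scale S x + right_act scale S y"
  "right_act scale S (x - y) = right_act scale S x - right_act scale S y"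
  "right_act scale (S + T) x = right_act scale S x + right_act scale T x"
  "right_act scale (S - T) x = right_act scale S x - right_act scale T x"
  "right_act scale (S ** T) x = right_act scale T (right_act scale S x)"
  "right_act scale 0 x = 0" "right_act scale S 0 = 0"
proof -
  show "right_act scale (S ** T) x = right_act scale T (right_act scale S x)"
    by (simp add: right_act_def matrix_matrix_mult_def vec_eq_iff scale_sum_left scale_sum_right
        mult.commute) (intro allI sum.swap)
qed (simp_all add: right_act_def vec_eq_iff algebra_simps sum.distrib sum_subtractf)

lemma left_right_act: "left_act scale S (right_act scale T x) = right_act scale T (left_act scale S x)"
  by (simp add: left_act_def right_act_def vec_eq_iff scale_sum_right mult.commute) (intro allI sum.swap)

end

section \<open>Identities for conjugation and the norm\<close>

locale octonion_algebra_char_not_2 = octonion_algebra scl mul one N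
  for scl :: "'f::field \<Rightarrow> 'o::ab_group_add \<Rightarrow> 'o" and mul one N +
  assumes char_not_2: "CHAR('f) \<noteq> 2"
begin

abbreviation cj :: "'o \<Rightarrow> 'o" where "cj \<equiv> oconj scl one N"

lemma two_neq_0: "(2::'f) \<noteq> 0"
  using two_nonzero char_not_2 by blast

lemmas cj_eq = oconj_eq[OF char_not_2]
lemmas cj_mul = oconj_mul[OF char_not_2]

lemma polar_self: "polar N x x = 2 * N x"
  using N_scale[of 2 x] scale_left_distrib[of 1 1 x] by (simp add: polar_def)

lemma mul_zero: "mul 0 x = 0" "mul x 0 = 0"
  using mul_simps(5)[of 0 0 x] mul_simps(6)[of x 0 0] by simp_all

lemma mul_uminus: "mul (- x) y = - mul x y" "mul x (- y) = - mul x y"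
  using mul_simps(5)[of 0 x y] mul_simps(6)[of x 0 y] by (simp_all add: mul_zero)

lemma mul_sum: "mul (\<Sum>k\<in>K. f k) y = (\<Sum>k\<in>K. mul (f k) y)" "mul y (\<Sum>k\<in>K. f k) = (\<Sum>k\<in>K. mul y (f k))"
  by (induction K rule: infinite_finite_induct) (simp_all add: mul_zero mul_simps)

lemma polar_zero: "polar N 0 x = 0" "polar N x 0 = 0"
  using polar_simps(5)[of x 0 0] polar_simps(6)[of 0 0 x] by simp_all

lemma polar_uminus: "polar N (- x) y = - polar N x y" "polar N x (- y) = - polar N x y"
  using polar_simps(5)[of x 0 y] polar_simps(6)[of 0 x y] by (simp_all add: polar_zero)

lemma polar_sum: "polar N x (\<Sum>k\<in>K. f k) = (\<Sum>k\<in>K. polar N x (f k))"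
  by (induction K rule: infinite_finite_induct) (simp_all add: polar_zero polar_simps)

lemma cj_simps:
  "cj (x + y) = cj x + cj y" "cj (x - y) = cj x - cj y" "cj (scl c x) = scl c (cj x)"
  "cj 0 = 0" "cj (- x) = - cj x" "cj (cj x) = x" "cj one = one"
proof -
  have "scl 2 one = one + one" using scale_left_distrib[of 1 1 one] by simp
  then show "cj one = one" "cj (cj x) = x"
    by (simp_all add: cj_eq polar_simps polar_one_one scale_left_diff_distrib
        mult.commute[of _ 2] scale_left_distrib flip: mult_2)
qed (simp_all add: cj_eq polar_simps polar_zero polar_uminus algebra_simps)

lemma cj_sum: "cj (\<Sum>k\<in>K. f k) = (\<Sum>k\<in>K. cj (f k))"
  by (induction K rule: infinite_finite_induct) (simp_all add: cj_simps)

lemma cj_imaginary: "polar N one x = 0 \<Longrightarrow> cj x = - x"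
  by (simp add: cj_eq)

text \<open>If \<open>x\<close> equals its conjugate then twice \<open>x\<close> is its trace, and
  two is invertible. This makes the diagonal entries of hermitian matrices scalar.\<close>

lemma cj_fixed:
  assumes "cj x = x"
  obtains c where "x = scl c one"
proof
  have "scl (polar N one x) one = scl 2 x"
    using assms scale_left_distrib[of 1 1 x] by (simp add: cj_eq algebra_simps)
  then have "scl (1 / 2) (scl (polar N one x) one) = scl (1 / 2) (scl 2 x)" by simp
  then show "x = scl (polar N one x / 2) one"
    using two_neq_0 by simp
qed

text \<open>Putting \<open>one\<close> in the third place of \<open>polar_exchange\<close> leaves
  the trace of \<open>u\<close> minus \<open>u\<close>, which is \<open>cj u\<close>.\<close>

lemma polar_adjoint_left: "polar N (mul u v) w = polar N v (mul (cj u) w)"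
  using polar_exchange[of u v one w]
  by (simp add: cj_eq mul_simps polar_simps one_mul polar_commute[of one u] algebra_simps)

lemma polar_adjoint_right: "polar N (mul u v) w = polar N u (mul w (cj v))"
  using polar_exchange[of u v w one]
  by (simp add: cj_eq mul_simps polar_simps mul_one polar_commute[of one v]
      polar_commute[of "mul w v" u] algebra_simps)

lemma polar_cj: "polar N (cj x) (cj y) = polar N x y"
  by (simp add: cj_eq polar_simps polar_one_one polar_commute[of x one] algebra_simps)

text \<open>Paired with any \<open>w\<close>, the left multiplications move across as adjoints, and
  the exchange identity for \<open>cj x\<close> and \<open>cj y\<close> remains; conjugation
  preserves the form. This is the linearised form of \<open>mul_cj_self\<close>.\<close>

lemma mul_cj_polarized: "mul x (mul (cj y) z) + mul y (mul (cj x) z) = scl (polar N x y) z"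
proof (rule polar_eqI)
  fix w
  have "polar N (mul x (mul (cj y) z) + mul y (mul (cj x) z)) w =
      polar N (mul (cj y) z) (mul (cj x) w) + polar N (mul (cj x) z) (mul (cj y) w)"
    by (simp add: polar_simps polar_adjoint_left[of _ _ w])
  also have "\<dots> = polar N (cj x) (cj y) * polar N z w"
    using polar_exchange[of "cj y" z "cj x" w]
    by (simp add: polar_commute)
  finally show "polar N (mul x (mul (cj y) z) + mul y (mul (cj x) z)) w =
      polar N (scl (polar N x y) z) w"
    by (simp add: polar_cj polar_simps)
qed

lemma mul_cj_add: "mul x (cj y) + mul y (cj x) = scl (polar N x y) one"
  using mul_cj_polarized[of x y one] by (simp add: mul_one)

lemma mul_cj_self: "mul x (mul (cj x) z) = scl (N x) z"
proof -
  have "scl 2 (mul x (mul (cj x) z)) = scl 2 (scl (N x) z)"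
    using mul_cj_polarized[of x x z] scale_left_distrib[of 1 1 "mul x (mul (cj x) z)"]
    by (simp add: polar_self)
  then show ?thesis using two_neq_0 scale_left_imp_eq by blast
qed

subsection \<open>The left nucleus\<close>

definition orthogonal_to :: "'o \<Rightarrow> 'o set \<Rightarrow> bool" where
  "orthogonal_to v B \<longleftrightarrow> (\<forall>b\<in>B. polar N b v = 0)"

text \<open>The members must be anisotropic, not merely nonzero: a split algebra has nonzero vectors
  of norm 0, along which there is no orthogonal projection.\<close>

definition orthogonal_family :: "'o set \<Rightarrow> bool" where
  "orthogonal_family B \<longleftrightarrow>
     finite B \<and> (\<forall>b\<in>B. N b \<noteq> 0) \<and> (\<forall>b\<in>B. \<forall>b'\<in>B. b \<noteq> b' \<longrightarrow> polar N b b' = 0)"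

text \<open>One Gram-Schmidt step; the denominator is \<open>polar N b b\<close>.\<close>

definition orthogonal_part :: "'o set \<Rightarrow> 'o \<Rightarrow> 'o" where
  "orthogonal_part B x = x - (\<Sum>b\<in>B. scl (polar N b x / (2 * N b)) b)"

lemma orthogonal_part:
  assumes "orthogonal_family B"
  shows "orthogonal_to (orthogonal_part B x) B"
  unfolding orthogonal_to_def
proof
  fix b assume b: "b \<in> B"
  have "(\<Sum>b'\<in>B. polar N b' x / (2 * N b') * polar N b b') =
      (\<Sum>b'\<in>B. if b' = b then polar N b x else 0)"
    using assms b two_neq_0
    by (intro sum.cong) (auto simp: orthogonal_family_def polar_self)
  then show "polar N b (orthogonal_part B x) = 0"
    using assms b by (simp add: orthogonal_part_def polar_simps polar_sum orthogonal_family_def)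
qed

lemma polar_diff_orthogonal_part:
  assumes "orthogonal_to v B"
  shows "polar N v (x - orthogonal_part B x) = 0"
proof -
  have "polar N v b = 0" if "b \<in> B" for b
    using assms that by (simp add: orthogonal_to_def polar_commute[of v b])
  then show ?thesis
    by (simp add: orthogonal_part_def polar_sum polar_simps(2))
qed

text \<open>If \<open>N\<close> vanished on the complement of \<open>B\<close>, so would its polar
  form there. Every orthogonal part would then lie in the radical, hence be 0, and fewer than 8
  vectors would span the algebra.\<close>

lemma orthogonal_anisotropic_exists:
  assumes B: "orthogonal_family B" and card: "card B < 8"
  shows "\<exists>v. orthogonal_to v B \<and> N v \<noteq> 0"
proof (rule ccontr)
  assume "\<not> ?thesis"
  then have isotropic: "N v = 0" if "orthogonal_to v B" for v using that by blast
  have fin: "finite B" using B by (simp add: orthogonal_family_def)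
  have "x \<in> span B" for x
  proof -
    let ?p = "orthogonal_part B"
    have "polar N (?p x) y = polar N 0 y" for y
    proof -
      have o: "orthogonal_to (?p x) B" "orthogonal_to (?p y) B"
        using orthogonal_part[OF B] by auto
      then have "orthogonal_to (?p x + ?p y) B"
        by (simp add: orthogonal_to_def polar_simps)
      then have "polar N (?p x) (?p y) = 0"
        using isotropic o by (simp add: polar_def)
      moreover have "polar N (?p x) (y - ?p y) = 0"
        using o by (simp add: polar_diff_orthogonal_part)
      ultimately show ?thesis by (simp add: polar_simps polar_zero)
    qed
    then have "?p x = 0" by (rule polar_eqI)
    then have "x = (\<Sum>b\<in>B. scl (polar N b x / (2 * N b)) b)"
      by (simp add: orthogonal_part_def)
    then show ?thesis
      by (metis (no_types, lifting) span_base span_scale span_sum)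
  qed
  then have "dim UNIV \<le> card B" using fin by (intro dim_le_card) auto
  then show False using card dim_8 by simp
qed

definition quaternionic :: "'o \<Rightarrow> 'o \<Rightarrow> bool" where
  "quaternionic i j \<longleftrightarrow> N i \<noteq> 0 \<and> N j \<noteq> 0 \<and>
     polar N one i = 0 \<and> polar N one j = 0 \<and> polar N i j = 0"

text \<open>For a quaternionic pair this is an orthogonal basis of the quaternion subalgebra
  generated by \<open>i\<close> and \<open>j\<close>.\<close>

definition quat_basis :: "'o \<Rightarrow> 'o \<Rightarrow> 'o set" where
  "quat_basis i j = {one, i, j, mul i j}"

lemma quaternionic_orthogonal_family:
  assumes "quaternionic i j"
  shows "orthogonal_family (quat_basis i j)"
proof -
  have "polar N one (mul i j) = 0"
    using assms polar_adjoint_left[of i j one]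
    by (simp add: quaternionic_def cj_imaginary mul_one polar_commute polar_uminus)
  moreover have "polar N i (mul i j) = 0"
    using assms polar_mul_left[of i one j] by (simp add: quaternionic_def mul_one)
  moreover have "polar N j (mul i j) = 0"
    using assms polar_mul_right[of one j i] by (simp add: quaternionic_def one_mul)
  ultimately show ?thesis
    using assms polar_commute[of i one] polar_commute[of j one] polar_commute[of "mul i j" one]
      polar_commute[of j i] polar_commute[of "mul i j" i] polar_commute[of "mul i j" j]
    by (auto simp: orthogonal_family_def quat_basis_def quaternionic_def N_one N_mul)
qed

text \<open>The Cayley-Dickson rule: moving \<open>v\<close> to the left conjugates the factor it
  passes, which turns \<open>mul i (mul j v)\<close> into \<open>mul (mul j i) v\<close>, and
  \<open>i\<close>, \<open>j\<close> anticommute.\<close>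

lemma associator_orthogonal:
  assumes i: "polar N one i = 0" and j: "polar N one j = 0" and ij: "polar N i j = 0"
    and v: "orthogonal_to v (quat_basis i j)"
  shows "mul (mul i j) v - mul i (mul j v) = scl 2 (mul (mul i j) v)"
proof -
  have v': "polar N one v = 0" "polar N i v = 0" "polar N j v = 0" "polar N (mul i j) v = 0"
    using v by (auto simp: orthogonal_to_def quat_basis_def)
  have ji: "mul j i = - mul i j"
    using mul_cj_add[of i j] i j ij
    by (simp add: cj_imaginary mul_uminus eq_neg_iff_add_eq_0 add.commute)
  have swap: "mul x v = mul v (cj x)" if "polar N x v = 0" for x
    using mul_cj_add[of x v] that v' by (simp add: cj_imaginary mul_uminus)
  have "mul i (mul j v) = mul i (mul v (cj j))"
    using swap v' by simp
  also have "\<dots> = mul v (mul (cj i) (cj j))"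
    using mul_cj_polarized[of i v "cj j"] v' by (simp add: cj_imaginary mul_uminus)
  also have "\<dots> = mul (mul j i) v"
    using swap[of "mul j i"] v' by (simp add: ji polar_uminus flip: cj_mul)
  finally show ?thesis
    using scale_left_distrib[of 1 1 "mul (mul i j) v"] by (simp add: ji mul_uminus)
qed

text \<open>Nuclearity of \<open>u\<close> is applied to \<open>cj y\<close> and
  \<open>cj x\<close>; the adjoints of the right multiplications then carry both factors over to
  \<open>z\<close>.\<close>

lemma left_nucleus_orthogonal_associator:
  assumes "\<And>a b. mul (mul u a) b = mul u (mul a b)"
  shows "polar N u (mul (mul z x) y - mul z (mul x y)) = 0"
proof -
  have "polar N (mul (mul u (cj y)) (cj x)) z = polar N (mul u (mul (cj y) (cj x))) z"
    by (simp add: assms)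
  then show ?thesis
    by (simp add: polar_adjoint_right[of _ _ z] polar_adjoint_right[of u] polar_simps cj_mul
        cj_simps)
qed

text \<open>With \<open>k = mul i j\<close>, the vector \<open>mul k e\<close> is again orthogonal
  to the quaternion basis, and its associator with \<open>i\<close> and \<open>j\<close> is
  \<open>- 2 N k\<close> times \<open>e\<close>. So \<open>e\<close> is a nonzero multiple of an
  associator.\<close>

lemma left_nucleus_orthogonal:
  assumes u: "\<And>a b. mul (mul u a) b = mul u (mul a b)"
    and q: "quaternionic i j" and e: "orthogonal_to e (quat_basis i j)"
  shows "polar N u e = 0"
proof -
  let ?k = "mul i j"
  have q': "polar N one i = 0" "polar N one j = 0" "polar N i j = 0" "N i \<noteq> 0" "N j \<noteq> 0"
    using q by (auto simp: quaternionic_def)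
  have e': "polar N one e = 0" "polar N i e = 0" "polar N j e = 0" "polar N ?k e = 0"
    using e by (auto simp: orthogonal_to_def quat_basis_def)
  have k: "polar N one ?k = 0" "polar N ?k i = 0" "polar N ?k j = 0"
    using q' polar_adjoint_left[of i j one] polar_mul_left[of i j one] polar_mul_right[of i j one]
    by (auto simp: cj_imaginary mul_one one_mul polar_commute polar_uminus)
  have ck: "cj ?k = - ?k" using k by (simp add: cj_imaginary)
  let ?v = "mul ?k e"
  have "mul i ?k = scl (- N i) j"
    using mul_cj_self[of i j] q' by (simp add: cj_imaginary mul_uminus minus_equation_iff)
  then have "polar N (mul i ?k) e = 0" using e' by (simp add: polar_simps polar_uminus)
  moreover have "- mul j j = scl (N j) one"
    using mul_cj_self[of j one] q' by (simp add: cj_imaginary mul_uminus mul_one)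
  then have "mul j j = scl (- N j) one" by (metis minus_minus scale_minus_left)
  then have "mul ?k j = scl (- N j) i"
    using right_alternative[of i j] by (simp add: mul_simps mul_one mul_uminus)
  then have "polar N (mul ?k j) e = 0" using e' by (simp add: polar_simps polar_uminus)
  moreover have "mul ?k i = - mul i ?k"
    using mul_cj_add[of i ?k] k q'
    by (simp add: cj_imaginary mul_uminus eq_neg_iff_add_eq_0 add.commute polar_commute[of i ?k])
  ultimately have "orthogonal_to ?v (quat_basis i j)"
    using e' k q' polar_adjoint_left[of ?k e one] polar_adjoint_left[of ?k e i]
      polar_adjoint_left[of ?k e j] polar_mul_left[of ?k one e]
    by (auto simp: orthogonal_to_def quat_basis_def ck mul_one mul_uminus polar_uminus
        polar_commute[of one "mul ?k e"] polar_commute[of i "mul ?k e"] polar_commute[of j "mul ?k e"]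
        polar_commute[of e ?k] polar_commute[of e i] polar_commute[of e j] polar_commute[of e one]
        polar_commute[of e "mul i ?k"] polar_commute[of e "mul ?k j"])
  then have "polar N u (scl 2 (mul ?k ?v)) = 0"
    using associator_orthogonal[of i j ?v] left_nucleus_orthogonal_associator[OF u, of i j ?v] q'
    by simp
  moreover have "mul ?k ?v = scl (- N ?k) e"
    using mul_cj_self[of ?k e] by (simp add: ck mul_uminus minus_equation_iff)
  ultimately show ?thesis
    using two_neq_0 q' by (simp add: polar_simps polar_uminus N_mul)
qed

text \<open>By the preceding lemma \<open>u\<close> is orthogonal to the complement of the
  quaternion subalgebra of \<open>i\<close> and \<open>j\<close>. A third generator \<open>v\<close>
  handles the imaginary quaternions: \<open>j\<close> and \<open>mul i j\<close> are orthogonal to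
  \<open>quat_basis i v\<close>, and \<open>i\<close> to \<open>quat_basis j v\<close>.\<close>

lemma left_nucleus_scalar:
  assumes u: "\<And>a b. mul (mul u a) b = mul u (mul a b)"
  obtains c where "u = scl c one"
proof -
  have "orthogonal_family {one}" by (simp add: orthogonal_family_def N_one)
  then obtain i where i: "polar N one i = 0" "N i \<noteq> 0"
    using orthogonal_anisotropic_exists[of "{one}"] by (auto simp: orthogonal_to_def)
  have "orthogonal_family {one, i}"
    using i by (auto simp: orthogonal_family_def N_one polar_commute[of i one])
  moreover have "card {one, i} < 8" by (simp add: card_insert_if)
  ultimately obtain j where j: "polar N one j = 0" "polar N i j = 0" "N j \<noteq> 0"
    using orthogonal_anisotropic_exists[of "{one, i}"] by (auto simp: orthogonal_to_def)
  have ij: "quaternionic i j" using i j by (simp add: quaternionic_def)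
  let ?B = "quat_basis i j"
  note B = quaternionic_orthogonal_family[OF ij]
  have "card ?B < 8"
    by (simp add: quat_basis_def card_insert_if)
  with B obtain v where v: "orthogonal_to v ?B" "N v \<noteq> 0"
    using orthogonal_anisotropic_exists[of ?B] by blast
  then have v': "polar N one v = 0" "polar N i v = 0" "polar N j v = 0" "polar N (mul i j) v = 0"
    by (auto simp: orthogonal_to_def quat_basis_def)
  have iv: "quaternionic i v" and jv: "quaternionic j v"
    using i j v v' by (auto simp: quaternionic_def)
  have ji: "mul j i = - mul i j"
    using mul_cj_add[of i j] i j
    by (simp add: cj_imaginary mul_uminus eq_neg_iff_add_eq_0 add.commute)
  have k: "polar N one (mul i j) = 0" "polar N i (mul i j) = 0"
    using B ij polar_adjoint_left[of i j one] polar_mul_left[of i one j] i j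
    by (auto simp: cj_imaginary mul_one polar_commute polar_uminus)
  have "polar N (mul i v) j = 0" "polar N (mul j v) i = 0"
    using polar_adjoint_left[of i v j] polar_adjoint_left[of j v i] i j v'
    by (auto simp: cj_imaginary mul_uminus polar_uminus ji polar_commute[of v "mul i j"])
  moreover have "polar N (mul i v) (mul i j) = 0"
    using polar_mul_left[of i v j] v' by (simp add: polar_commute)
  ultimately have "orthogonal_to j (quat_basis i v)" "orthogonal_to (mul i j) (quat_basis i v)"
    "orthogonal_to i (quat_basis j v)"
    using i j v' k by (auto simp: orthogonal_to_def quat_basis_def polar_commute[of j i]
        polar_commute[of v i] polar_commute[of v j] polar_commute[of v "mul i j"])
  then have ou: "polar N u i = 0" "polar N u j = 0" "polar N u (mul i j) = 0"
    using left_nucleus_orthogonal[OF u] iv jv by blast+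
  \<comment> \<open>The imaginary part of \<open>u\<close>, to be shown orthogonal to both
    components of an arbitrary \<open>x\<close>.\<close>
  let ?u = "u - scl (polar N one u / 2) one"
  have u1: "polar N ?u one = 0"
    using two_neq_0 by (simp add: polar_simps polar_one_one polar_commute)
  have "polar N ?u x = polar N 0 x" for x
  proof -
    let ?p = "orthogonal_part ?B x"
    have o: "orthogonal_to ?p ?B" using orthogonal_part[OF B] .
    then have "polar N u ?p = 0" "polar N one ?p = 0"
      using left_nucleus_orthogonal[OF u ij] by (auto simp: orthogonal_to_def quat_basis_def)
    then have "polar N ?u ?p = 0" by (simp add: polar_simps)
    moreover have "orthogonal_to ?u ?B"
      using ou u1 i j k polar_commute[of u i] polar_commute[of u j] polar_commute[of u "mul i j"]
        polar_commute[of i one] polar_commute[of j one] polar_commute[of "mul i j" one]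
        polar_commute[of "scl (polar N one u / 2) one" one] polar_commute[of u one]
      by (auto simp: orthogonal_to_def quat_basis_def polar_simps)
    then have "polar N ?u (x - ?p) = 0" by (rule polar_diff_orthogonal_part)
    ultimately show ?thesis by (simp add: polar_simps(5) polar_zero)
  qed
  then have "?u = 0" by (rule polar_eqI)
  then show thesis using that by simp
qed

section \<open>Cancelling two, and products of octonion matrices\<close>

lemma double_cancel: "(x::'o) + x = y + y \<longleftrightarrow> x = y"
proof
  assume "x + x = y + y"
  then have "scl 2 x = scl 2 y"
    using scale_left_distrib[of 1 1 x] scale_left_distrib[of 1 1 y] by simp
  then show "x = y" using two_neq_0 by simp
qed simp

lemma double_eq_0: "(x::'o) + x = 0 \<longleftrightarrow> x = 0"
  using double_cancel[of x 0] by simp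

lemma one_neq_0: "one \<noteq> 0"
  using polar_one_one two_neq_0 by (auto simp: polar_zero)

lemma omatmul_simps:
  "omatmul mul (x + y) z = omatmul mul x z + omatmul mul y z"
  "omatmul mul z (x + y) = omatmul mul z x + omatmul mul z y"
  "omatmul mul (x - y) z = omatmul mul x z - omatmul mul y z"
  "omatmul mul z (x - y) = omatmul mul z x - omatmul mul z y"
  "omatmul mul 0 z = 0" "omatmul mul z 0 = 0"
  by (simp_all add: omatmul_def vec_eq_iff mul_simps mul_zero sum.distrib sum_subtractf)

text \<open>Scalars associate with all octonions, so a scalar matrix can be rebracketed past
  octonion matrices although these do not associate among themselves.\<close>

lemma omatmul_act:
  "omatmul mul (left_act scl S x) y = left_act scl S (omatmul mul x y)"
  "omatmul mul x (right_act scl S y) = right_act scl S (omatmul mul x y)"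
  "omatmul mul (right_act scl S x) y = omatmul mul x (left_act scl S y)"
  by (simp_all add: omatmul_def left_act_def right_act_def vec_eq_iff mul_sum mul_simps
      scale_sum_right) (intro conjI allI sum.swap)+

subsection \<open>Derivations of the octonions\<close>

abbreviation oct_derivations where "oct_derivations \<equiv> derivations (oct_alg scl mul)"

lemma oct_derivations_iff:
  "\<delta> \<in> oct_derivations \<longleftrightarrow> (\<forall>x y. \<delta> (x + y) = \<delta> x + \<delta> y) \<and>
     (\<forall>c x. \<delta> (scl c x) = scl c (\<delta> x)) \<and> (\<forall>x y. \<delta> (mul x y) = mul (\<delta> x) y + mul x (\<delta> y))"
  by (simp add: derivations_def oct_alg_def)

context
  fixes \<delta> assumes \<delta>: "\<delta> \<in> oct_derivations"
begin

lemma oct_derivation_simps: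
  "\<delta> (x + y) = \<delta> x + \<delta> y" "\<delta> (scl c x) = scl c (\<delta> x)"
  "\<delta> (mul x y) = mul (\<delta> x) y + mul x (\<delta> y)"
  "\<delta> 0 = 0" "\<delta> (x - y) = \<delta> x - \<delta> y" "\<delta> one = 0"
proof -
  show *: "\<delta> (x + y) = \<delta> x + \<delta> y" "\<delta> (mul x y) = mul (\<delta> x) y + mul x (\<delta> y)" "\<delta> (scl c x) = scl c (\<delta> x)"
    for c x y
    using \<delta> by (auto simp: oct_derivations_iff)
  show "\<delta> 0 = 0" using *(1)[of 0 0] by simp
  show "\<delta> (x - y) = \<delta> x - \<delta> y" using *(1)[of "x - y" y] by simp
  show "\<delta> one = 0" using *(2)[of one one] by (simp add: mul_one one_mul)
qed

lemma oct_derivation_sum: "\<delta> (\<Sum>k\<in>K. f k) = (\<Sum>k\<in>K. \<delta> (f k))"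
  by (induction K rule: infinite_finite_induct) (simp_all add: oct_derivation_simps)

text \<open>Differentiating the quadratic equation of \<open>x\<close> and comparing with its
  polarised form shows that \<open>?t'\<close> times \<open>x\<close> is scalar. If
  \<open>?t'\<close> were nonzero, \<open>x\<close> would be scalar and
  \<open>\<delta> x = 0\<close>, a contradiction.\<close>

lemma oct_derivation_imaginary: "polar N one (\<delta> x) = 0"
proof (rule ccontr)
  let ?t = "polar N one x" and ?t' = "polar N one (\<delta> x)"
  assume t': "?t' \<noteq> 0"
  have "mul x (cj x) = scl (N x) one"
    using mul_cj_self[of x one] by (simp add: mul_one)
  then have "mul x x = scl ?t x - scl (N x) one"
    by (simp add: cj_eq mul_simps mul_one algebra_simps)
  then have "\<delta> (mul x x) = scl ?t (\<delta> x)"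
    by (simp add: oct_derivation_simps(2,5,6))
  then have "mul (\<delta> x) x + mul x (\<delta> x) = scl ?t (\<delta> x)"
    by (simp add: oct_derivation_simps(3))
  moreover have "scl ?t (\<delta> x) - mul (\<delta> x) x + (scl ?t' x - mul x (\<delta> x)) = scl (polar N (\<delta> x) x) one"
    using mul_cj_add[of "\<delta> x" x] by (simp add: cj_eq mul_simps mul_one)
  ultimately have "scl ?t' x = scl (polar N (\<delta> x) x) one"
    by (simp add: algebra_simps)
  then have "scl (1 / ?t') (scl ?t' x) = scl (1 / ?t') (scl (polar N (\<delta> x) x) one)" by simp
  then have "x = scl (polar N (\<delta> x) x / ?t') one" using t' by simp
  then have "\<delta> x = 0" by (metis oct_derivation_simps(2,6) scale_zero_right)
  with t' show False by (simp add: polar_zero)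
qed

lemma oct_derivation_cj: "\<delta> (cj x) = cj (\<delta> x)"
  by (simp add: cj_eq oct_derivation_simps oct_derivation_imaginary)

end

subsection \<open>Hermitian matrices\<close>

definition herm :: "'o ^ 'n ^ 'n \<Rightarrow> bool" where
  "herm x \<longleftrightarrow> (\<forall>i j. cj (x $ j $ i) = x $ i $ j)"

definition jmul :: "'o ^ 'n ^ 'n \<Rightarrow> 'o ^ 'n ^ 'n \<Rightarrow> 'o ^ 'n ^ 'n" where
  "jmul x y = omatmul mul x y + omatmul mul y x"

definition matrix_scale :: "'f \<Rightarrow> 'o ^ 'n ^ 'n \<Rightarrow> 'o ^ 'n ^ 'n" where
  "matrix_scale c x = (\<chi> i j. scl c (x $ i $ j))"

definition diag_unit :: "'n::finite \<Rightarrow> 'o ^ 'n ^ 'n" where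
  "diag_unit i = (\<chi> p q. if p = i \<and> q = i then one else 0)"

text \<open>For \<open>i \<noteq> j\<close> these matrices form an off-diagonal Peirce space. Both
  \<open>diag_unit i\<close> and \<open>diag_unit j\<close> act on it with eigenvalue 1, since the
  anticommutator is not halved.\<close>

definition off_diag :: "'n::finite \<Rightarrow> 'n \<Rightarrow> 'o \<Rightarrow> 'o ^ 'n ^ 'n" where
  "off_diag i j a = (\<chi> p q. if p = i \<and> q = j then a else if p = j \<and> q = i then cj a else 0)"

lemma herm_cj: "herm x \<Longrightarrow> cj (x $ j $ i) = x $ i $ j"
  by (simp add: herm_def)

lemma herm_diag_unit: "herm (diag_unit i)"
  by (simp add: herm_def diag_unit_def cj_simps)

lemma herm_off_diag: "i \<noteq> j \<Longrightarrow> herm (off_diag i j a)"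
  by (auto simp: herm_def off_diag_def cj_simps)

lemma herm_diff: "herm x \<Longrightarrow> herm y \<Longrightarrow> herm (x - y)"
  by (simp add: herm_def cj_simps)

lemma herm_scale: "herm x \<Longrightarrow> herm (matrix_scale c x)"
  by (simp add: herm_def cj_simps matrix_scale_def)

lemma herm_zero: "herm 0"
  by (simp add: herm_def cj_simps)

lemma jmul_commute: "jmul x y = jmul y x"
  by (simp add: jmul_def add.commute)

lemma herm_jmul: "herm x \<Longrightarrow> herm y \<Longrightarrow> herm (jmul x y)"
  by (simp add: herm_def jmul_def omatmul_def cj_simps cj_sum cj_mul add.commute)

lemma jmul_zero: "jmul 0 x = 0" "jmul x 0 = 0"
  by (simp_all add: jmul_def omatmul_simps)

lemma jmul_diag_unit_nth:
  "jmul (diag_unit i) x $ p $ q = (if p = i then x $ i $ q else 0) + (if q = i then x $ p $ i else 0)"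
proof -
  have l: "mul (if p = i \<and> k = i then one else 0) (x $ k $ q) =
      (if k = i then if p = i then x $ i $ q else 0 else 0)"
    and r: "mul (x $ p $ k) (if k = i \<and> q = i then one else 0) =
      (if k = i then if q = i then x $ p $ i else 0 else 0)" for k
    by (auto simp: one_mul mul_one mul_zero)
  show ?thesis
    by (simp add: jmul_def omatmul_def diag_unit_def l r)
qed

lemma jmul_off_diag_nth:
  assumes "i \<noteq> j"
  shows "jmul (off_diag i j a) x $ p $ q =
    (if p = i then mul a (x $ j $ q) else if p = j then mul (cj a) (x $ i $ q) else 0) +
    (if q = j then mul (x $ p $ i) a else if q = i then mul (x $ p $ j) (cj a) else 0)"
proof -
  have l: "mul (if p = i \<and> k = j then a else if p = j \<and> k = i then cj a else 0) (x $ k $ q) =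
      (if k = j then if p = i then mul a (x $ j $ q) else 0 else 0) +
      (if k = i then if p = j then mul (cj a) (x $ i $ q) else 0 else 0)"
    and r: "mul (x $ p $ k) (if k = i \<and> q = j then a else if k = j \<and> q = i then cj a else 0) =
      (if k = i then if q = j then mul (x $ p $ i) a else 0 else 0) +
      (if k = j then if q = i then mul (x $ p $ j) (cj a) else 0 else 0)" for k
    using assms by (auto simp: mul_zero)
  show ?thesis
    using assms by (simp add: jmul_def omatmul_def off_diag_def l r sum.distrib)
qed

lemma diag_unit_nth: "diag_unit i $ p $ q = (if p = i \<and> q = i then one else 0)"
  by (simp add: diag_unit_def)

lemma off_diag_nth:
  "off_diag i j a $ p $ q = (if p = i \<and> q = j then a else if p = j \<and> q = i then cj a else 0)"
  by (simp add: off_diag_def)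

lemma jmul_diag_unit_self: "jmul (diag_unit i) (diag_unit i) = diag_unit i + diag_unit i"
  by (simp add: vec_eq_iff jmul_diag_unit_nth diag_unit_nth)

lemma jmul_diag_units: "i \<noteq> j \<Longrightarrow> jmul (diag_unit i) (diag_unit j) = 0"
  by (simp add: vec_eq_iff jmul_diag_unit_nth diag_unit_nth)

lemma jmul_diag_unit_off_diag:
  "i \<noteq> j \<Longrightarrow> jmul (diag_unit i) (off_diag i j a) = off_diag i j a"
  "i \<noteq> j \<Longrightarrow> jmul (diag_unit j) (off_diag i j a) = off_diag i j a"
  by (auto simp: vec_eq_iff jmul_diag_unit_nth off_diag_nth)

lemma jmul_off_diags:
  "\<lbrakk>i \<noteq> j; j \<noteq> k; i \<noteq> k\<rbrakk> \<Longrightarrow> jmul (off_diag i j a) (off_diag j k b) = off_diag i k (mul a b)"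
  by (auto simp: vec_eq_iff jmul_off_diag_nth off_diag_nth mul_zero cj_mul)

lemma off_diag_swap: "i \<noteq> j \<Longrightarrow> off_diag i j a = off_diag j i (cj a)"
  by (auto simp: vec_eq_iff off_diag_nth cj_simps)

lemma off_diag_add: "off_diag i j (a + b) = off_diag i j a + off_diag i j b"
  by (simp add: vec_eq_iff off_diag_nth cj_simps)

lemma off_diag_scale: "off_diag i j (scl c a) = matrix_scale c (off_diag i j a)"
  by (simp add: vec_eq_iff off_diag_nth cj_simps matrix_scale_def)

text \<open>Multiplying by two distinct diagonal idempotents is the Peirce projection, a form that a
  derivation killing the idempotents commutes with.\<close>

lemma jmul_diag_unit_twice:
  assumes "herm x" "i \<noteq> j"
  shows "jmul (diag_unit i) (jmul (diag_unit j) x) = off_diag i j (x $ i $ j)"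
  using assms by (auto simp: vec_eq_iff jmul_diag_unit_nth off_diag_nth herm_def)

subsection \<open>Derivations of hermitian matrices\<close>

abbreviation herm_derivations :: "('o ^ 'n ^ 'n \<Rightarrow> 'o ^ 'n ^ 'n) set" where
  "herm_derivations \<equiv> derivations (herm_alg scl mul one N)"

lemma herm_derivations_iff:
  "D \<in> herm_derivations \<longleftrightarrow>
     (\<forall>x. herm x \<longrightarrow> herm (D x)) \<and> (\<forall>x. \<not> herm x \<longrightarrow> D x = 0) \<and>
     (\<forall>x y. herm x \<longrightarrow> herm y \<longrightarrow> D (x + y) = D x + D y) \<and>
     (\<forall>c x. herm x \<longrightarrow> D (matrix_scale c x) = matrix_scale c (D x)) \<and>
     (\<forall>x y. herm x \<longrightarrow> herm y \<longrightarrow> D (jmul x y) = jmul (D x) y + jmul x (D y))"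
  unfolding derivations_def
  by (auto simp: herm_alg_def adjoint_matrix_def map_matrix_def transpose_def vec_eq_iff
      herm_def jmul_def matrix_scale_def)

context
  fixes D :: "'o ^ 'n ^ 'n \<Rightarrow> 'o ^ 'n ^ 'n" assumes D: "D \<in> herm_derivations"
begin

lemma herm_derivation_simps:
  "herm x \<Longrightarrow> herm (D x)" "\<not> herm x \<Longrightarrow> D x = 0"
  "herm x \<Longrightarrow> herm y \<Longrightarrow> D (x + y) = D x + D y"
  "herm x \<Longrightarrow> D (matrix_scale c x) = matrix_scale c (D x)"
  "herm x \<Longrightarrow> herm y \<Longrightarrow> D (jmul x y) = jmul (D x) y + jmul x (D y)"
  using D by (auto simp: herm_derivations_iff)

lemma herm_derivation_diff: "herm x \<Longrightarrow> herm y \<Longrightarrow> D (x - y) = D x - D y"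
  using herm_derivation_simps(3)[of "x - y" y] by (simp add: herm_diff)

lemma herm_derivation_zero: "D 0 = 0"
  using herm_derivation_diff[of 0 0] by (simp add: herm_zero)

text \<open>Differentiating \<open>jmul_diag_unit_self\<close> gives
  \<open>?y = jmul (diag_unit i) ?y\<close>. The right side vanishes off row and column
  \<open>i\<close> and doubles the entry at \<open>(i, i)\<close>.\<close>

lemma derivation_diag_unit_nth:
  assumes "p = i \<longleftrightarrow> q = i"
  shows "D (diag_unit i) $ p $ q = 0"
proof -
  let ?y = "D (diag_unit i)"
  have "?y + ?y = jmul (diag_unit i) ?y + jmul (diag_unit i) ?y"
    using herm_derivation_simps(3,5)[of "diag_unit i" "diag_unit i"]
    by (simp add: herm_diag_unit jmul_diag_unit_self jmul_commute[of ?y])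
  then have "?y $ p $ q + ?y $ p $ q = jmul (diag_unit i) ?y $ p $ q + jmul (diag_unit i) ?y $ p $ q"
    by (metis vector_add_component)
  then have "?y $ p $ q = jmul (diag_unit i) ?y $ p $ q" by (simp only: double_cancel)
  then show ?thesis using assms by (auto simp: jmul_diag_unit_nth)
qed

lemma derivation_diag_unit_antisym:
  assumes "i \<noteq> j"
  shows "D (diag_unit i) $ i $ j = - D (diag_unit j) $ i $ j"
proof -
  have "jmul (D (diag_unit i)) (diag_unit j) + jmul (diag_unit i) (D (diag_unit j)) = 0"
    using herm_derivation_simps(5)[of "diag_unit i" "diag_unit j"] assms
    by (simp add: herm_diag_unit jmul_diag_units herm_derivation_zero)
  then have "(jmul (diag_unit j) (D (diag_unit i)) + jmul (diag_unit i) (D (diag_unit j))) $ i $ j = 0"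
    by (simp add: jmul_commute)
  then show ?thesis using assms by (simp add: jmul_diag_unit_nth eq_neg_iff_add_eq_0)
qed

text \<open>Differentiate the product of \<open>diag_unit i\<close> and
  \<open>off_diag i j a\<close>, which is the second factor. At \<open>(l, j)\<close> multiplication
  by \<open>diag_unit i\<close> contributes nothing.\<close>

lemma derivation_off_diag_nth:
  assumes "i \<noteq> j" "l \<noteq> i" "l \<noteq> j"
  shows "D (off_diag i j a) $ l $ j = mul (D (diag_unit i) $ l $ i) a"
proof -
  have "D (off_diag i j a) = jmul (D (diag_unit i)) (off_diag i j a) + jmul (diag_unit i) (D (off_diag i j a))"
    using herm_derivation_simps(5)[of "diag_unit i" "off_diag i j a"] assms
    by (simp add: herm_diag_unit herm_off_diag jmul_diag_unit_off_diag)
  then have "D (off_diag i j a) $ l $ j =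
      (jmul (off_diag i j a) (D (diag_unit i)) + jmul (diag_unit i) (D (off_diag i j a))) $ l $ j"
    by (simp add: jmul_commute)
  then show ?thesis using assms by (simp add: jmul_diag_unit_nth jmul_off_diag_nth)
qed

text \<open>This is where four indices are needed: for \<open>n = 3\<close> the entries of \<open>D (diag_unit i)\<close>
  need not be scalar.\<close>

lemma derivation_diag_unit_scalar:
  assumes card: "CARD('n) \<ge> 4"
  shows "\<exists>c. D (diag_unit i) $ l $ i = scl c one"
proof (cases "l = i")
  case True
  then have "D (diag_unit i) $ l $ i = scl 0 one" by (simp add: derivation_diag_unit_nth)
  then show ?thesis by blast
next
  case False
  let ?w = "D (diag_unit i) $ l $ i"
  obtain j where j: "j \<noteq> i" "j \<noteq> l" by (rule obtain_fourth_index[OF card, of i l l])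
  obtain k where k: "k \<noteq> i" "k \<noteq> l" "k \<noteq> j" by (rule obtain_fourth_index[OF card, of i l j])
  have "mul (mul ?w a) b = mul ?w (mul a b)" for a b
  proof -
    have "D (off_diag i k (mul a b)) =
        jmul (D (off_diag i j a)) (off_diag j k b) + jmul (off_diag i j a) (D (off_diag j k b))"
      using herm_derivation_simps(5)[of "off_diag i j a" "off_diag j k b"] j k
      by (simp add: herm_off_diag jmul_off_diags)
    \<comment> \<open>Neither \<open>l\<close> nor \<open>k\<close> lies in \<open>{i, j}\<close>,
      so the summand with the factor \<open>off_diag i j a\<close> has entry 0 here.\<close>
    then have "D (off_diag i k (mul a b)) $ l $ k =
        (jmul (off_diag j k b) (D (off_diag i j a)) + jmul (off_diag i j a) (D (off_diag j k b))) $ l $ k"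
      by (simp add: jmul_commute)
    then show ?thesis
      using j k False by (simp add: jmul_off_diag_nth derivation_off_diag_nth)
  qed
  then show ?thesis using left_nucleus_scalar by blast
qed

end

text \<open>Such a \<open>D\<close> commutes with multiplication by every
  \<open>diag_unit i\<close>, hence with the Peirce projections; so entries can be treated singly
  without writing \<open>x\<close> as a sum.\<close>

lemma derivation_eq_zero:
  assumes D: "D \<in> herm_derivations" and diag: "\<And>i. D (diag_unit i) = 0"
    and off: "\<And>i j a. i \<noteq> j \<Longrightarrow> D (off_diag i j a) = 0"
  shows "D = (\<lambda>x. 0)"
proof
  fix x
  show "D x = 0"
  proof (cases "herm x")
    case x: True
    note ds = herm_derivation_simps[OF D]
    have dj: "D (jmul (diag_unit i) y) = jmul (diag_unit i) (D y)" if "herm y" for i y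
      using ds(5)[of "diag_unit i" y] that by (simp add: herm_diag_unit diag jmul_zero)
    have "D x $ i $ j = 0" if "i \<noteq> j" for i j
    proof -
      have "D (jmul (diag_unit i) (jmul (diag_unit j) x)) = jmul (diag_unit i) (jmul (diag_unit j) (D x))"
        using x by (simp add: dj herm_jmul herm_diag_unit)
      then have "off_diag i j (D x $ i $ j) = 0"
        using x that ds(1) by (simp add: jmul_diag_unit_twice off)
      then have "off_diag i j (D x $ i $ j) $ i $ j = 0" by simp
      then show ?thesis by (simp add: off_diag_nth)
    qed
    moreover have "D x $ i $ i = 0" for i
    proof -
      \<comment> \<open>\<open>?P\<close> annihilates all entries but \<open>(i, i)\<close>, which
        it doubles: there the two terms contribute four and two copies.\<close>
      let ?P = "\<lambda>y. jmul (diag_unit i) (jmul (diag_unit i) y) - jmul (diag_unit i) y"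
      obtain c where c: "x $ i $ i = scl c one" using herm_cj[OF x] cj_fixed by metis
      have "?P x = matrix_scale (2 * c) (diag_unit i)"
        using scale_left_distrib[of c c one]
        by (auto simp: vec_eq_iff jmul_diag_unit_nth diag_unit_nth matrix_scale_def c)
      then have "D (?P x) = 0"
        by (simp add: ds(4) herm_diag_unit diag) (simp add: matrix_scale_def vec_eq_iff)
      then have "?P (D x) $ i $ i = 0"
        using x by (simp add: herm_derivation_diff[OF D] dj herm_jmul herm_diag_unit)
      then have "D x $ i $ i + D x $ i $ i = 0" by (simp add: jmul_diag_unit_nth)
      then show ?thesis by (simp add: double_eq_0)
    qed
    ultimately show ?thesis by (metis (mono_tags, lifting) vec_eq_iff zero_index)
  qed (use D herm_derivation_simps in auto)
qed

lemma off_diag_derivation: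
  fixes D :: "'o ^ 'n ^ 'n \<Rightarrow> 'o ^ 'n ^ 'n"
  assumes card: "CARD('n) \<ge> 4"
    and D: "D \<in> herm_derivations" and diag: "\<And>i. D (diag_unit i) = 0"
  obtains \<delta> where "\<delta> \<in> oct_derivations" "\<And>i j a. i \<noteq> j \<Longrightarrow> D (off_diag i j a) = off_diag i j (\<delta> a)"
proof -
  note ds = herm_derivation_simps[OF D]
  define d where "d i j a = D (off_diag i j a) $ i $ j" for i j a
  \<comment> \<open>The image is fixed by multiplication with both idempotents, as the argument is,
    so it stays in the same Peirce space.\<close>
  have Doff: "D (off_diag i j a) = off_diag i j (d i j a)" if ij: "i \<noteq> j" for i j a
  proof -
    let ?y = "D (off_diag i j a)"
    have "herm ?y" using ij by (simp add: ds herm_off_diag)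
    moreover have "?y = jmul (diag_unit i) ?y" "?y = jmul (diag_unit j) ?y"
      using ds(5)[of "diag_unit i" "off_diag i j a"] ds(5)[of "diag_unit j" "off_diag i j a"] ij
      by (simp_all add: herm_diag_unit herm_off_diag jmul_diag_unit_off_diag diag jmul_zero)
    then have "?y = jmul (diag_unit i) (jmul (diag_unit j) ?y)" by simp
    ultimately show ?thesis using ij by (simp add: jmul_diag_unit_twice d_def)
  qed
  have d_cj: "d j i (cj a) = cj (d i j a)" if "i \<noteq> j" for i j a
    using that ds(1)[of "off_diag i j a"]
    by (simp add: d_def off_diag_swap[of i j, symmetric] herm_off_diag herm_cj)
  have d_mul: "d i k (mul a b) = mul (d i j a) b + mul a (d j k b)"
    if "i \<noteq> j" "j \<noteq> k" "i \<noteq> k" for i j k a b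
  proof -
    have "off_diag i k (d i k (mul a b)) = off_diag i k (mul (d i j a) b) + off_diag i k (mul a (d j k b))"
      using ds(5)[of "off_diag i j a" "off_diag j k b"] that
      by (simp add: herm_off_diag jmul_off_diags Doff)
    then have "off_diag i k (d i k (mul a b)) $ i $ k = off_diag i k (mul (d i j a) b + mul a (d j k b)) $ i $ k"
      by (simp add: off_diag_add)
    then show ?thesis by (simp add: off_diag_nth)
  qed
  have d_one_real: "cj (d i j one) = d i j one" if ij: "i \<noteq> j" for i j
  proof -
    obtain k where k: "k \<noteq> i" "k \<noteq> j" by (rule obtain_fourth_index[OF card, of i j j])
    obtain l where l: "l \<noteq> i" "l \<noteq> j" "l \<noteq> k" by (rule obtain_fourth_index[OF card, of i j k])
    \<comment> \<open>Expanding \<open>d i l (mul a b)\<close> through \<open>k\<close> and through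
      \<open>j\<close>, with a factor \<open>one\<close> inserted at \<open>(i, j)\<close>, gives
      the two bracketings; all other terms agree.\<close>
    have "mul (mul (d i j one) a) b = mul (d i j one) (mul a b)" for a b
      using d_mul[of i k l "mul one a" b] d_mul[of i j k one a]
        d_mul[of i j l one "mul a b"] d_mul[of j k l a b] k l ij
      by (simp add: one_mul mul_simps)
    then obtain c where "d i j one = scl c one" by (rule left_nucleus_scalar)
    then show ?thesis by (simp add: cj_simps)
  qed
  have d_one: "d i j one = 0" if ij: "i \<noteq> j" for i j
  proof -
    obtain k where k: "k \<noteq> i" "k \<noteq> j" by (rule obtain_fourth_index[OF card, of i j j])
    have "d j i one = d i j one"
      using d_cj[OF ij, of one] d_one_real[OF ij] by (simp add: cj_simps)
    \<comment> \<open>The relations for \<open>d k j one\<close> and \<open>d k i one\<close>, added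
      together, give \<open>d i j one + d j i one = 0\<close>.\<close>
    then have "d i j one + d i j one = 0"
      using d_mul[of k i j one one] d_mul[of k j i one one] k ij by (simp add: one_mul mul_one)
    then show ?thesis by (simp add: double_eq_0)
  qed
  have d_right: "d i k = d i j" if "i \<noteq> j" "i \<noteq> k" for i j k
  proof (cases "j = k")
    case False
    show ?thesis
      using d_mul[of i j k _ one] that False by (intro ext) (simp add: d_one mul_one mul_zero)
  qed simp
  have d_left: "d i k = d j k" if "j \<noteq> k" "i \<noteq> k" for i j k
  proof (cases "i = j")
    case False
    show ?thesis
      using d_mul[of i j k one] that False by (intro ext) (simp add: d_one one_mul mul_zero)
  qed simp
  obtain p :: 'n where True by simp
  obtain q where q: "q \<noteq> p" by (rule obtain_fourth_index[OF card, of p p p])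
  \<comment> \<open>The second index is changed to \<open>q\<close> and then the first to
    \<open>p\<close>. When \<open>i = q\<close> this would pass through a diagonal position, so a
    detour is made through a third index.\<close>
  have d_eq: "d i j = d p q" if "i \<noteq> j" for i j
  proof (cases "i = q")
    case False
    then show ?thesis using that q d_right[of i j q] d_left[of p q i] by simp
  next
    case True
    obtain k where k: "k \<noteq> p" "k \<noteq> q" by (rule obtain_fourth_index[OF card, of p q q])
    have "d i j = d i k" using that True k by (intro d_right) auto
    also have "\<dots> = d p k" using True k by (intro d_left) auto
    also have "\<dots> = d p q" using q k by (intro d_right) auto
    finally show ?thesis .
  qed
  obtain k where k: "k \<noteq> p" "k \<noteq> q" by (rule obtain_fourth_index[OF card, of p q q])
  have "d p q (mul a b) = mul (d p q a) b + mul a (d p q b)" for a b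
    using d_mul[of p k q a b] d_eq[of p k] d_eq[of k q] k q by simp
  then have "d p q \<in> oct_derivations"
    unfolding oct_derivations_iff
    using q by (simp add: d_def off_diag_add off_diag_scale ds herm_off_diag) (simp add: matrix_scale_def)
  then show thesis using that Doff d_eq by metis
qed

section \<open>The joint action of octonion derivations and antisymmetric scalar matrices\<close>

text \<open>The value 0 off the hermitian matrices matches the representation of derivations as
  functions extended by 0.\<close>

definition herm_action :: "('o \<Rightarrow> 'o) \<Rightarrow> 'f ^ 'n ^ 'n \<Rightarrow> 'o ^ 'n ^ 'n \<Rightarrow> 'o ^ 'n ^ 'n" where
  "herm_action \<delta> S x = (if herm x then map_matrix \<delta> x + left_act scl S x - right_act scl S x else 0)"

lemma herm_action_zero_nth:
  "herm x \<Longrightarrow> herm_action \<delta> 0 x $ i $ j = \<delta> (x $ i $ j)"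
  by (simp add: herm_action_def left_act_simps right_act_simps map_matrix_def)

lemma herm_action_diag_unit_nth:
  assumes "\<delta> \<in> oct_derivations"
  shows "herm_action \<delta> S (diag_unit i) $ p $ q =
    (if q = i then scl (S $ p $ i) one else 0) - (if p = i then scl (S $ i $ q) one else 0)"
proof -
  have l: "scl (S $ p $ k) (if k = i \<and> q = i then one else 0) =
      (if k = i then if q = i then scl (S $ p $ i) one else 0 else 0)"
    and r: "scl (S $ k $ q) (if p = i \<and> k = i then one else 0) =
      (if k = i then if p = i then scl (S $ i $ q) one else 0 else 0)" for k
    by auto
  show ?thesis
    using assms by (simp add: herm_action_def herm_diag_unit map_matrix_def left_act_def right_act_def
        diag_unit_nth l r oct_derivation_simps)
qed

lemma map_matrix_oct_derivation:
  assumes "\<delta> \<in> oct_derivations"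
  shows "map_matrix \<delta> (x + y) = map_matrix \<delta> x + map_matrix \<delta> y"
    "map_matrix \<delta> (x - y) = map_matrix \<delta> x - map_matrix \<delta> y"
    "map_matrix \<delta> (left_act scl S x) = left_act scl S (map_matrix \<delta> x)"
    "map_matrix \<delta> (right_act scl S x) = right_act scl S (map_matrix \<delta> x)"
    "map_matrix \<delta> (omatmul mul x y) = omatmul mul (map_matrix \<delta> x) y + omatmul mul x (map_matrix \<delta> y)"
  by (simp_all add: map_matrix_def left_act_def right_act_def omatmul_def vec_eq_iff
      oct_derivation_sum[OF assms] oct_derivation_simps[OF assms] sum.distrib)

text \<open>Because \<open>S\<close> is antisymmetric, taking adjoints turns \<open>S x\<close> into
  \<open>- x S\<close> and vice versa, while \<open>\<delta>\<close> commutes with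
  conjugation.\<close>

lemma herm_herm_action:
  assumes \<delta>: "\<delta> \<in> oct_derivations" and S: "transpose S = - S" and x: "herm x"
  shows "herm (herm_action \<delta> S x)"
proof -
  have S': "scl (S $ j $ i) y = - scl (S $ i $ j) y" for i j y
    by (subst antisymmetric_nth[OF S]) simp
  have cj_act: "cj (left_act scl S x $ j $ i) = (\<Sum>k\<in>UNIV. scl (S $ j $ k) (x $ i $ k))"
    "cj (right_act scl S x $ j $ i) = (\<Sum>k\<in>UNIV. scl (S $ k $ i) (x $ k $ j))" for i j
    using x by (simp_all add: left_act_def right_act_def cj_sum cj_simps herm_cj)
  have "cj (left_act scl S x $ j $ i) = - right_act scl S x $ i $ j" for i j
    unfolding cj_act by (simp add: right_act_def S'[of j] sum_negf)
  moreover have "cj (right_act scl S x $ j $ i) = - left_act scl S x $ i $ j" for i j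
    unfolding cj_act by (simp add: left_act_def S'[of _ i] sum_negf)
  moreover have "cj (map_matrix \<delta> x $ j $ i) = map_matrix \<delta> x $ i $ j" for i j
    using x by (simp add: map_matrix_def herm_cj flip: oct_derivation_cj[OF \<delta>])
  ultimately show ?thesis
    using x by (simp add: herm_def[of "herm_action \<delta> S x"]) (simp add: herm_action_def cj_simps)
qed

text \<open>In the Leibniz rule for the commutator with \<open>S\<close>, the inner terms
  \<open>(x S) y\<close> and \<open>x (S y)\<close> cancel.\<close>

lemma herm_action_derivation:
  assumes \<delta>: "\<delta> \<in> oct_derivations" and S: "transpose S = - S"
  shows "herm_action \<delta> S \<in> herm_derivations"
proof -
  have add: "herm (x + y)" if "herm x" "herm y" for x y :: "'o ^ 'n ^ 'n"
    using that by (simp add: herm_def cj_simps)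
  have "herm_action \<delta> S (x + y) = herm_action \<delta> S x + herm_action \<delta> S y" if "herm x" "herm y" for x y
    using that add[OF that]
    by (simp add: herm_action_def left_act_simps right_act_simps)
      (simp add: map_matrix_def vec_eq_iff oct_derivation_simps[OF \<delta>])
  moreover have "herm_action \<delta> S (matrix_scale c x) = matrix_scale c (herm_action \<delta> S x)" if "herm x" for c x
    using that by (simp add: herm_action_def herm_scale vec_eq_iff)
      (simp add: map_matrix_def matrix_scale_def left_act_def right_act_def
        oct_derivation_simps[OF \<delta>] scale_sum_right mult.commute scale_right_distrib
        scale_right_diff_distrib)
  moreover have "herm_action \<delta> S (jmul x y) = jmul (herm_action \<delta> S x) y + jmul x (herm_action \<delta> S y)"
    if "herm x" "herm y" for x y
    using that herm_jmul[OF that]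
    by (simp add: herm_action_def jmul_def)
      (simp add: map_matrix_oct_derivation[OF \<delta>] omatmul_simps omatmul_act left_act_simps right_act_simps)
  moreover have "herm_action \<delta> S x = 0" if "\<not> herm x" for x
    using that by (simp add: herm_action_def)
  ultimately show ?thesis
    unfolding herm_derivations_iff using herm_herm_action[OF assms] by blast
qed

lemma der_herm_alg_simps:
  "ncarrier (der (herm_alg scl mul one N :: ('f, 'o ^ 'n ^ 'n) nalg)) = herm_derivations"
  "nscale (der (herm_alg scl mul one N)) c D = (\<lambda>x. matrix_scale c (D x))"
  "nprod (der (herm_alg scl mul one N)) D E = (D \<circ> E) - (E \<circ> D)"
  by (simp_all add: der_def herm_alg_def matrix_scale_def)

lemma herm_derivations_diff:
  fixes D E :: "'o ^ 'n ^ 'n \<Rightarrow> 'o ^ 'n ^ 'n"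
  assumes "D \<in> herm_derivations" "E \<in> herm_derivations"
  shows "D - E \<in> herm_derivations"
proof -
  have "is_nalg (der (herm_alg scl mul one N :: ('f, 'o ^ 'n ^ 'n) nalg))"
    using is_lie_algebra_der[OF is_nalg_herm_alg[OF char_not_2]] unfolding is_lie_algebra_def by blast
  from ncarrier_diff[OF this, of D E] show ?thesis
    using assms by (simp add: der_herm_alg_simps)
qed

lemma zero_oct_derivation: "(\<lambda>x. 0) \<in> oct_derivations"
  by (simp add: oct_derivations_iff mul_zero)

lemma herm_derivation_decompose:
  fixes D :: "'o ^ 'n ^ 'n \<Rightarrow> 'o ^ 'n ^ 'n"
  assumes card: "CARD('n) \<ge> 4" and D: "D \<in> herm_derivations"
  obtains \<delta> S where "\<delta> \<in> oct_derivations" "transpose S = - S" "D = herm_action \<delta> S"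
proof -
  have "\<forall>l i. \<exists>c. D (diag_unit i) $ l $ i = scl c one"
    using derivation_diag_unit_scalar[OF D card] by blast
  then obtain s where s: "D (diag_unit i) $ l $ i = scl (s l i) one" for l i
    by metis
  define S :: "'f ^ 'n ^ 'n" where "S = (\<chi> l i. s l i)"
  have herm_D: "cj (D (diag_unit i) $ p $ q) = D (diag_unit i) $ q $ p" for i p q
    using herm_derivation_simps(1)[OF D herm_diag_unit] herm_cj by blast
  \<comment> \<open>Hermiticity carries the scalars of column \<open>i\<close> over to row
    \<open>i\<close>.\<close>
  have s': "D (diag_unit i) $ i $ l = scl (s l i) one" for i l
    using herm_D[of i l i] by (simp add: s cj_simps)
  have s_antisym: "s l i = - s i l" for l i
  proof -
    have "scl (s l i) one = scl (- s i l) one"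
    proof (cases "l = i")
      case True
      then have "scl (s l i) one = 0"
        using s[of i l] derivation_diag_unit_nth[OF D, of l i i] by simp
      then show ?thesis using one_neq_0 True by simp
    next
      case False
      then show ?thesis
        using derivation_diag_unit_antisym[OF D, of i l] by (simp add: s s')
    qed
    then show ?thesis using one_neq_0 by (simp only: scale_cancel_right) simp
  qed
  have antisym: "transpose S = - S"
    by (simp add: S_def transpose_def vec_eq_iff) (intro allI s_antisym)
  let ?R = "herm_action (\<lambda>x. 0) S"
  have DR_diag: "(D - ?R) (diag_unit i) = 0" for i
  proof -
    have "D (diag_unit i) $ p $ q = ?R (diag_unit i) $ p $ q" for p q
    proof (cases "p = i \<longleftrightarrow> q = i")
      case True
      then show ?thesis
        using derivation_diag_unit_nth[OF D, of p i q]
        by (auto simp: herm_action_diag_unit_nth[OF zero_oct_derivation])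
    next
      case False
      then show ?thesis
        using s[of i p] s'[of i q] s_antisym[of q i]
        by (auto simp: herm_action_diag_unit_nth[OF zero_oct_derivation] S_def)
    qed
    then show ?thesis by (simp add: vec_eq_iff)
  qed
  have DR: "D - ?R \<in> herm_derivations"
    by (intro herm_derivations_diff D herm_action_derivation zero_oct_derivation antisym)
  with DR_diag obtain \<delta> where \<delta>: "\<delta> \<in> oct_derivations"
    and DR_off: "\<And>i j a. i \<noteq> j \<Longrightarrow> (D - ?R) (off_diag i j a) = off_diag i j (\<delta> a)"
    using off_diag_derivation[OF card] by metis
  \<comment> \<open>\<open>?E\<close> agrees with \<open>D - ?R\<close> on all diagonal units and
    off-diagonal elements, which determine a derivation.\<close>
  let ?E = "herm_action \<delta> 0 :: 'o ^ 'n ^ 'n \<Rightarrow> _"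
  have E: "?E \<in> herm_derivations"
    by (rule herm_action_derivation[OF \<delta>]) (simp add: transpose_def vec_eq_iff)
  have E_diag: "?E (diag_unit i) = 0" for i
    by (simp add: vec_eq_iff herm_action_zero_nth herm_diag_unit diag_unit_nth
        oct_derivation_simps[OF \<delta>])
  have E_off: "?E (off_diag i j a) = off_diag i j (\<delta> a)" if "i \<noteq> j" for i j a
    using that by (simp add: vec_eq_iff herm_action_zero_nth herm_off_diag off_diag_nth
        oct_derivation_simps[OF \<delta>] oct_derivation_cj[OF \<delta>])
  have "D - ?R - ?E = (\<lambda>x. 0)"
    by (rule derivation_eq_zero[OF herm_derivations_diff[OF DR E]])
      (simp_all only: minus_apply[of "D - ?R"] DR_diag E_diag DR_off E_off diff_self not_False_eq_True)
  then have "D x = ?R x + ?E x" for x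
    by (simp add: fun_eq_iff algebra_simps)
  then have "D = herm_action \<delta> S"
    by (auto simp: fun_eq_iff herm_action_def left_act_simps right_act_simps map_matrix_def vec_eq_iff)
  with \<delta> antisym show thesis by (rule that)
qed

text \<open>On diagonal units \<open>\<delta>\<close> contributes nothing, as it kills
  \<open>one\<close>, so their images reveal the off-diagonal entries of \<open>S\<close>. A single
  off-diagonal position then reveals \<open>\<delta>\<close>.\<close>

lemma herm_action_inj:
  fixes S S' :: "'f ^ 'n ^ 'n"
  assumes \<delta>: "\<delta> \<in> oct_derivations" "\<delta>' \<in> oct_derivations"
    and S: "transpose S = - S" "transpose S' = - S'"
    and card: "CARD('n) \<ge> 2"
    and eq: "herm_action \<delta> S = herm_action \<delta>' S'"
  shows "\<delta> = \<delta>' \<and> S = S'"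
proof
  have diag: "S $ i $ i = 0" if "transpose S = - S" for S :: "'f ^ 'n ^ 'n" and i
  proof -
    have "S $ i $ i + S $ i $ i = 0"
      using antisymmetric_nth[OF that, of i i] by (simp only: eq_neg_iff_add_eq_0)
    then show ?thesis using two_neq_0 by (simp flip: mult_2)
  qed
  have "S $ p $ i = S' $ p $ i" for p i
  proof (cases "p = i")
    case False
    have "herm_action \<delta> S (diag_unit i) $ p $ i = herm_action \<delta>' S' (diag_unit i) $ p $ i"
      by (simp add: eq)
    then show ?thesis using False one_neq_0 by (simp add: herm_action_diag_unit_nth \<delta>)
  qed (simp add: diag S)
  then show "S = S'" by (simp add: vec_eq_iff)
  have "\<not> CARD('n) \<le> Suc 0" using card by simp
  then obtain i j :: 'n where ij: "i \<noteq> j" by (auto simp: card_le_Suc0_iff_eq)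
  show "\<delta> = \<delta>'"
  proof
    fix a
    have "map_matrix \<delta> (off_diag i j a) $ i $ j = map_matrix \<delta>' (off_diag i j a) $ i $ j"
      using fun_cong[OF eq, of "off_diag i j a"] herm_off_diag[OF ij] \<open>S = S'\<close>
      by (simp add: herm_action_def)
    then show "\<delta> a = \<delta>' a" by (simp add: map_matrix_def off_diag_nth)
  qed
qed

text \<open>The left and right actions commute with each other and with entrywise derivations, so
  all mixed terms cancel. The order reversal of the right action is absorbed by its minus
  sign.\<close>

lemma herm_action_bracket:
  fixes S S' :: "'f ^ 'n ^ 'n"
  assumes \<delta>: "\<delta> \<in> oct_derivations" "\<delta>' \<in> oct_derivations"
    and S: "transpose S = - S" "transpose S' = - S'"
  shows "herm_action ((\<delta> \<circ> \<delta>') - (\<delta>' \<circ> \<delta>)) (S ** S' - S' ** S) =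
    (herm_action \<delta> S \<circ> herm_action \<delta>' S') - (herm_action \<delta>' S' \<circ> herm_action \<delta> S)"
proof
  fix x :: "'o ^ 'n ^ 'n"
  have mc: "map_matrix ((\<delta> \<circ> \<delta>') - (\<delta>' \<circ> \<delta>)) x =
      map_matrix \<delta> (map_matrix \<delta>' x) - map_matrix \<delta>' (map_matrix \<delta> x)"
    by (simp add: map_matrix_def vec_eq_iff)
  show "herm_action ((\<delta> \<circ> \<delta>') - (\<delta>' \<circ> \<delta>)) (S ** S' - S' ** S) x =
    ((herm_action \<delta> S \<circ> herm_action \<delta>' S') - (herm_action \<delta>' S' \<circ> herm_action \<delta> S)) x"
  proof (cases "herm x")
    case True
    then have "herm (herm_action \<delta> S x)" "herm (herm_action \<delta>' S' x)"
      using herm_herm_action \<delta> S by blast+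
    with True show ?thesis
      by (simp add: herm_action_def mc)
        (simp add: map_matrix_oct_derivation[OF \<delta>(1)] map_matrix_oct_derivation[OF \<delta>(2)] left_act_simps right_act_simps left_right_act algebra_simps)
  next
    case False
    then have "herm_action \<epsilon> T x = 0" for \<epsilon> T by (simp add: herm_action_def)
    then show ?thesis
      using herm_derivation_zero[OF herm_action_derivation[OF \<delta>(1) S(1)]]
        herm_derivation_zero[OF herm_action_derivation[OF \<delta>(2) S(2)]]
      by simp
  qed
qed

end

theorem theorem3p3:
  fixes scl :: "'f::field \<Rightarrow> 'o::ab_group_add \<Rightarrow> 'o"
    and mul :: "'o \<Rightarrow> 'o \<Rightarrow> 'o" and one :: 'o and N :: "'o \<Rightarrow> 'f"
  assumes "CHAR('f) \<noteq> 2"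
    and "octonion_algebra scl mul one N"
    and "CARD('n::finite) \<ge> 4"
  shows "der (herm_alg scl mul one N :: ('f, 'o ^ 'n ^ 'n) nalg)
           \<cong>\<^sub>L der (oct_alg scl mul) \<oplus>\<^sub>L (so_alg :: ('f, 'f ^ 'n ^ 'n) nalg)"
proof -
  interpret octonion_algebra_char_not_2 scl mul one N
    using assms by (simp add: octonion_algebra_char_not_2_def octonion_algebra_char_not_2_axioms_def)
  let ?L = "der (oct_alg scl mul) \<oplus>\<^sub>L (so_alg :: ('f, 'f ^ 'n ^ 'n) nalg)"
  let ?H = "der (herm_alg scl mul one N :: ('f, 'o ^ 'n ^ 'n) nalg)"
  let ?\<phi> = "\<lambda>(\<delta>, S). herm_action \<delta> S :: 'o ^ 'n ^ 'n \<Rightarrow> _"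
  have L: "is_nalg ?L"
    using is_lie_algebra_sum[OF is_lie_algebra_der[OF is_nalg_oct_alg] is_lie_algebra_so]
    unfolding is_lie_algebra_def by blast
  have carrier: "ncarrier ?L = oct_derivations \<times> {S. transpose S = - S}"
    by (simp add: nalg_sum_def der_def so_alg_def)
  \<comment> \<open>Bijectivity is existence and uniqueness of the decomposition
    \<open>D = herm_action \<delta> S\<close>.\<close>
  have "bij_betw ?\<phi> (ncarrier ?L) (ncarrier ?H)"
    unfolding bij_betw_def
  proof
    show "inj_on ?\<phi> (ncarrier ?L)"
    proof (rule inj_onI)
      fix x y assume "x \<in> ncarrier ?L" "y \<in> ncarrier ?L" "?\<phi> x = ?\<phi> y"
      then show "x = y"
        using herm_action_inj[of "fst x" "fst y" "snd x" "snd y"] assms(3)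
        by (simp only: carrier mem_Times_iff mem_Collect_eq case_prod_beta prod_eq_iff)
    qed
    show "?\<phi> ` ncarrier ?L = ncarrier ?H"
    proof
      show "?\<phi> ` ncarrier ?L \<subseteq> ncarrier ?H"
        using herm_action_derivation by (auto simp: carrier der_herm_alg_simps)
      show "ncarrier ?H \<subseteq> ?\<phi> ` ncarrier ?L"
      proof
        fix D assume "D \<in> ncarrier ?H"
        then have "D \<in> herm_derivations" by (simp add: der_herm_alg_simps)
        then obtain \<delta> S where "\<delta> \<in> oct_derivations" "transpose S = - S" "D = herm_action \<delta> S"
          using herm_derivation_decompose assms(3) by metis
        then show "D \<in> ?\<phi> ` ncarrier ?L" by (force simp: carrier)
      qed
    qed
  qed
  moreover have "?\<phi> (x + y) = ?\<phi> x + ?\<phi> y" for x y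
    by (cases x; cases y) (simp add: fun_eq_iff herm_action_def left_act_simps right_act_simps
        map_matrix_def vec_eq_iff)
  moreover have "?\<phi> (nscale ?L c x) = nscale ?H c (?\<phi> x)" for c x
    by (cases x) (simp add: fun_eq_iff herm_action_def left_act_def right_act_def map_matrix_def
        vec_eq_iff nalg_sum_def der_def so_alg_def oct_alg_def herm_alg_def scale_sum_right
        scale_right_distrib scale_right_diff_distrib)
  moreover have "?\<phi> (nprod ?L x y) = nprod ?H (?\<phi> x) (?\<phi> y)"
    if "x \<in> ncarrier ?L" "y \<in> ncarrier ?L" for x y
    using that herm_action_bracket
    by (auto simp: carrier der_herm_alg_simps nalg_sum_def so_alg_def der_def oct_alg_def)
  ultimately have "nalg_iso ?L ?H ?\<phi>"
    by (simp only: nalg_iso_def) blast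
  then show ?thesis
    using nalg_iso_sym[OF L] by (auto simp: nalg_isomorphic_def)
qed

end
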